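(* Let $X$ be a proper, geodesically complete CAT(0) space with metric $d$, and let $x_{0}\in X$. For $t>0$ let $\Sigma_{x_0}(t):=\{y\in X: d(x_0,y)=t\}$ with the restriction of the metric of $X$. Suppose there exist some $K>0$ and a positive real function $\iota$ (called the refining increment) such that for all sufficiently large $t$: 1. $\lim_{s\rightarrow t^{+}}\iota(s)>0$ (in particular this holds if $\iota$ is lower semicontinuous from the right), and 2. if $d(x,y)<\iota(t)$ and $(x,y)$ is a sink in $\Sigma_{x_{0}}(t)$, then $x,y$ may be joined by a curve in $\Sigma_{x_0}(t)\cap B(x,K)\cap B(y,K)$. Then the boundary $\partial X$ is weakly chained, hence $X$ is semistable at infinity (has semistable fundamental group at infinity).
   Context: $B(x,K)$ is the open metric ball. A sink in a metric space $(Z,d)$ is a pair $(x,y)\in Z\times Z$ with $x\neq y$ at which the distance function $d:Z\times Z\to\mathbb{R}$ has a (possibly not strict) local minimum. Geodesically complete means every local geodesic segment extends to a geodesic line. $\partial X$ is the visual boundary with the cone topology, i.e. $\partial X$ is the inverse limit of the spheres $\Sigma_{x_0}(t)$ under geodesic projection toward $x_0$; it is a compact metrizable space. A compact metrizable space is given its unique compatible uniform structure, and it is called weakly chained if it is so for one (equivalently any) compatible metric in the following sense. In a metric space, for $\varepsilon>0$, an $\varepsilon$-chain is a finite sequence $\{x_0,\dots,x_n\}$ with $d(x_i,x_{i+1})<\varepsilon$ for all $i$. An $\varepsilon$-homotopy between two $\varepsilon$-chains with the same endpoints is a finite sequence of $\varepsilon$-chains, all with the same endpoints, starting at the first and ending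 at the second, in which each chain differs from the next by adding or removing a single point (never an endpoint). The $\varepsilon$-homotopy class of $\alpha$ is $[\alpha]_\varepsilon$, and $[x,y]_\varepsilon$ is the class of the two-point chain $\{x,y\}$. The metric space is chain connected if every pair of points is joined by an $\varepsilon$-chain for every $\varepsilon>0$. It is weakly chained if it is chain connected and for every $\varepsilon>0$ there is $\delta>0$ such that whenever $d(x,y)<\delta$, for every $\tau>0$ there is a $\tau$-chain $\alpha$ (which is also an $\varepsilon$-chain) from $x$ to $y$ with $[\alpha]_\varepsilon=[x,y]_\varepsilon$. A proper geodesic space is semistable at infinity if any two proper rays $[0,\infty)\to X$ converging to the same end are properly homotopic.
   Formalization: The boundary is shown to be weakly chained provided it is connected; without this the claim fails (X = ℝ has a two-point boundary, which is not chain connected). Semistability at infinity is proved without this proviso. *)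

theory Defs
  imports "HOL-Analysis.Analysis"
begin

section \<open>Weakly chained spaces\<close>

definition eps_chain :: "'a set \<Rightarrow> ('a \<Rightarrow> 'a \<Rightarrow> real) \<Rightarrow> real \<Rightarrow> 'a list \<Rightarrow> bool" where
  "eps_chain M d \<epsilon> xs \<longleftrightarrow>
     xs \<noteq> [] \<and> set xs \<subseteq> M \<and> (\<forall>i. Suc i < length xs \<longrightarrow> d (xs ! i) (xs ! Suc i) < \<epsilon>)"

definition inserts_point :: "'a list \<Rightarrow> 'a list \<Rightarrow> bool" where
  "inserts_point xs ys \<longleftrightarrow> (\<exists>us z vs. us \<noteq> [] \<and> vs \<noteq> [] \<and> xs = us @ vs \<and> ys = us @ z # vs)"

definition eps_step :: "'a set \<Rightarrow> ('a \<Rightarrow> 'a \<Rightarrow> real) \<Rightarrow> real \<Rightarrow> 'a list \<Rightarrow> 'a list \<Rightarrow> bool" where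
  "eps_step M d \<epsilon> xs ys \<longleftrightarrow>
     eps_chain M d \<epsilon> xs \<and> eps_chain M d \<epsilon> ys \<and> (inserts_point xs ys \<or> inserts_point ys xs)"

text \<open>Both lists are required to be chains explicitly, because the reflexive closure alone would
  relate an arbitrary list to itself.\<close>

definition eps_homotopic :: "'a set \<Rightarrow> ('a \<Rightarrow> 'a \<Rightarrow> real) \<Rightarrow> real \<Rightarrow> 'a list \<Rightarrow> 'a list \<Rightarrow> bool" where
  "eps_homotopic M d \<epsilon> xs ys \<longleftrightarrow>
     eps_chain M d \<epsilon> xs \<and> eps_chain M d \<epsilon> ys \<and> (eps_step M d \<epsilon>)\<^sup>*\<^sup>* xs ys"

definition chain_connected :: "'a set \<Rightarrow> ('a \<Rightarrow> 'a \<Rightarrow> real) \<Rightarrow> bool" where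
  "chain_connected M d \<longleftrightarrow>
     (\<forall>x\<in>M. \<forall>y\<in>M. \<forall>\<epsilon>>0. \<exists>xs. eps_chain M d \<epsilon> xs \<and> hd xs = x \<and> last xs = y)"

definition weakly_chained_metric :: "'a set \<Rightarrow> ('a \<Rightarrow> 'a \<Rightarrow> real) \<Rightarrow> bool" where
  "weakly_chained_metric M d \<longleftrightarrow>
     chain_connected M d \<and>
     (\<forall>\<epsilon>>0. \<exists>\<delta>>0. \<forall>x\<in>M. \<forall>y\<in>M. d x y < \<delta> \<longrightarrow>
        (\<forall>\<tau>>0. \<exists>\<alpha>. eps_chain M d \<tau> \<alpha> \<and> hd \<alpha> = x \<and> last \<alpha> = y \<and>
                   eps_homotopic M d \<epsilon> \<alpha> [x, y]))"

definition weakly_chained :: "'a topology \<Rightarrow> bool" where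
  "weakly_chained T \<longleftrightarrow>
     compact_space T \<and>
     (\<exists>d. Metric_space (topspace T) d \<and> Metric_space.mtopology (topspace T) d = T \<and>
          weakly_chained_metric (topspace T) d)"

text \<open>A weakly chained space is connected. The boundary of a CAT(0) space with several ends is not:
  the boundary of the real line consists of two isolated points.\<close>

lemma eps_chain_mono:
  assumes "eps_chain M d \<epsilon> xs"
    and "\<And>x y. x \<in> M \<Longrightarrow> y \<in> M \<Longrightarrow> d x y < \<epsilon> \<Longrightarrow> d' x y < \<epsilon>'"
  shows "eps_chain M d' \<epsilon>' xs"
  using assms unfolding eps_chain_def by (meson Suc_lessD nth_mem subsetD)

lemma eps_homotopic_mono:
  assumes "eps_homotopic M d \<epsilon> xs ys"
    and le: "\<And>x y. x \<in> M \<Longrightarrow> y \<in> M \<Longrightarrow> d x y < \<epsilon> \<Longrightarrow> d' x y < \<epsilon>'"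
  shows "eps_homotopic M d' \<epsilon>' xs ys"
proof -
  have "eps_step M d \<epsilon> us vs \<Longrightarrow> eps_step M d' \<epsilon>' us vs" for us vs
    unfolding eps_step_def using eps_chain_mono[of M d \<epsilon> _ d' \<epsilon>'] le by blast
  then have "(eps_step M d \<epsilon>)\<^sup>*\<^sup>* \<le> (eps_step M d' \<epsilon>')\<^sup>*\<^sup>*"
    by (intro rtranclp_mono) blast
  then show ?thesis
    using assms(1) eps_chain_mono[of M d \<epsilon> _ d' \<epsilon>'] le unfolding eps_homotopic_def by blast
qed

lemma weakly_chained_metric_transfer:
  assumes wc: "weakly_chained_metric M d"
    and 1: "\<And>\<epsilon>. \<epsilon> > 0 \<Longrightarrow> \<exists>\<delta>>0. \<forall>x\<in>M. \<forall>y\<in>M. d x y < \<delta> \<longrightarrow> d' x y < \<epsilon>"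
    and 2: "\<And>\<epsilon>. \<epsilon> > 0 \<Longrightarrow> \<exists>\<delta>>0. \<forall>x\<in>M. \<forall>y\<in>M. d' x y < \<delta> \<longrightarrow> d x y < \<epsilon>"
  shows "weakly_chained_metric M d'"
  unfolding weakly_chained_metric_def
proof (intro conjI allI impI)
  show "chain_connected M d'"
    unfolding chain_connected_def
  proof (intro ballI allI impI)
    fix x y and \<epsilon> :: real assume "x \<in> M" "y \<in> M" "\<epsilon> > 0"
    obtain \<delta> where "\<delta> > 0" "\<forall>x\<in>M. \<forall>y\<in>M. d x y < \<delta> \<longrightarrow> d' x y < \<epsilon>"
      using 1 \<open>\<epsilon> > 0\<close> by blast
    moreover obtain xs where "eps_chain M d \<delta> xs" "hd xs = x" "last xs = y"
      using wc \<open>\<delta> > 0\<close> \<open>x \<in> M\<close> \<open>y \<in> M\<close>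
      unfolding weakly_chained_metric_def chain_connected_def by blast
    ultimately show "\<exists>xs. eps_chain M d' \<epsilon> xs \<and> hd xs = x \<and> last xs = y"
      using eps_chain_mono[of M d \<delta> xs d' \<epsilon>] by blast
  qed
next
  fix \<epsilon> :: real assume "\<epsilon> > 0"
  then obtain \<epsilon>0 where \<epsilon>0: "\<epsilon>0 > 0" "\<forall>x\<in>M. \<forall>y\<in>M. d x y < \<epsilon>0 \<longrightarrow> d' x y < \<epsilon>"
    using 1 by blast
  then obtain \<delta>0 where "\<delta>0 > 0" and \<delta>0: "\<forall>x\<in>M. \<forall>y\<in>M. d x y < \<delta>0 \<longrightarrow>
        (\<forall>\<tau>>0. \<exists>\<alpha>. eps_chain M d \<tau> \<alpha> \<and> hd \<alpha> = x \<and> last \<alpha> = y \<and>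
                   eps_homotopic M d \<epsilon>0 \<alpha> [x, y])"
    using wc unfolding weakly_chained_metric_def by blast
  obtain \<delta> where \<delta>: "\<delta> > 0" "\<forall>x\<in>M. \<forall>y\<in>M. d' x y < \<delta> \<longrightarrow> d x y < \<delta>0"
    using 2 \<open>\<delta>0 > 0\<close> by blast
  have "\<exists>\<alpha>. eps_chain M d' \<tau> \<alpha> \<and> hd \<alpha> = x \<and> last \<alpha> = y \<and> eps_homotopic M d' \<epsilon> \<alpha> [x, y]"
    if xy: "x \<in> M" "y \<in> M" "d' x y < \<delta>" and "\<tau> > 0" for x y and \<tau> :: real
  proof -
    obtain \<tau>0 where \<tau>0: "\<tau>0 > 0" "\<forall>x\<in>M. \<forall>y\<in>M. d x y < \<tau>0 \<longrightarrow> d' x y < \<tau>"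
      using 1 \<open>\<tau> > 0\<close> by blast
    obtain \<alpha> where \<alpha>: "eps_chain M d \<tau>0 \<alpha>" "hd \<alpha> = x" "last \<alpha> = y"
        "eps_homotopic M d \<epsilon>0 \<alpha> [x, y]"
      using \<delta>0 \<delta> \<tau>0 xy by meson
    have "eps_chain M d' \<tau> \<alpha>"
      using eps_chain_mono[OF \<alpha>(1)] \<tau>0 by blast
    moreover have "eps_homotopic M d' \<epsilon> \<alpha> [x, y]"
      using eps_homotopic_mono[OF \<alpha>(4)] \<epsilon>0 by blast
    ultimately show ?thesis
      using \<alpha> by blast
  qed
  then show "\<exists>\<delta>>0. \<forall>x\<in>M. \<forall>y\<in>M. d' x y < \<delta> \<longrightarrow>
        (\<forall>\<tau>>0. \<exists>\<alpha>. eps_chain M d' \<tau> \<alpha> \<and> hd \<alpha> = x \<and> last \<alpha> = y \<and>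
                   eps_homotopic M d' \<epsilon> \<alpha> [x, y])"
    using \<delta>(1) by blast
qed

lemma compact_compatible_metrics_uniform:
  assumes d: "Metric_space M d" and d': "Metric_space M d'"
    and eq: "Metric_space.mtopology M d = Metric_space.mtopology M d'"
    and cpt: "compact_space (Metric_space.mtopology M d)"
    and "\<epsilon> > 0"
  shows "\<exists>\<delta>>0. \<forall>x\<in>M. \<forall>y\<in>M. d x y < \<delta> \<longrightarrow> d' x y < \<epsilon>"
proof -
  have [simp]: "mspace (metric (M, d)) = M" "mspace (metric (M, d')) = M"
      "mdist (metric (M, d)) = d" "mdist (metric (M, d')) = d'"
      "mtopology_of (metric (M, d)) = Metric_space.mtopology M d"
      "mtopology_of (metric (M, d')) = Metric_space.mtopology M d'"
    using d d' by (simp_all add: Metric_space.mspace_metric Metric_space.mdist_metric mtopology_of_def)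
  have "continuous_map (mtopology_of (metric (M, d))) (mtopology_of (metric (M, d'))) id"
    using eq by simp
  then have "uniformly_continuous_map (metric (M, d)) (metric (M, d')) id"
    using cpt continuous_eq_uniformly_continuous_map[of "metric (M, d)" "metric (M, d')" id] by simp
  then show ?thesis
    using \<open>\<epsilon> > 0\<close> d d' unfolding uniformly_continuous_map_def
    by (simp) (metis Metric_space.commute)
qed

lemma weakly_chained_iff_all_metrics:
  "weakly_chained T \<longleftrightarrow>
     compact_space T \<and> metrizable_space T \<and>
     (\<forall>d. Metric_space (topspace T) d \<and> Metric_space.mtopology (topspace T) d = T \<longrightarrow>
          weakly_chained_metric (topspace T) d)"
proof -
  have "weakly_chained_metric (topspace T) d'"
    if "compact_space T"
      "Metric_space (topspace T) d" "Metric_space.mtopology (topspace T) d = T"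
      "Metric_space (topspace T) d'" "Metric_space.mtopology (topspace T) d' = T"
      "weakly_chained_metric (topspace T) d" for d d'
    using that
    by (intro weakly_chained_metric_transfer[of "topspace T" d d'] compact_compatible_metrics_uniform)
       simp_all
  moreover have "metrizable_space T \<longleftrightarrow>
      (\<exists>d. Metric_space (topspace T) d \<and> Metric_space.mtopology (topspace T) d = T)"
    unfolding metrizable_space_def by (metis Metric_space.topspace_mtopology)
  ultimately show ?thesis
    unfolding weakly_chained_def by blast
qed


section \<open>CAT(0) spaces\<close>

text \<open>A space \<open>X\<close> is a type of class \<open>metric_space\<close>, so that \<open>X\<close> is \<open>UNIV\<close>.\<close>

definition isometric_on :: "real set \<Rightarrow> (real \<Rightarrow> 'a::metric_space) \<Rightarrow> bool" where
  "isometric_on I c \<longleftrightarrow> (\<forall>s\<in>I. \<forall>t\<in>I. dist (c s) (c t) = \<bar>s - t\<bar>)"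

definition geodesic_from_to :: "(real \<Rightarrow> 'a::metric_space) \<Rightarrow> 'a \<Rightarrow> 'a \<Rightarrow> bool" where
  "geodesic_from_to c x y \<longleftrightarrow> isometric_on {0..dist x y} c \<and> c 0 = x \<and> c (dist x y) = y"

definition geodesic_space :: "'a::metric_space itself \<Rightarrow> bool" where
  "geodesic_space _ \<longleftrightarrow> (\<forall>x y::'a. \<exists>c. geodesic_from_to c x y)"

text \<open>The CAT(0) inequality for geodesic triangles with comparison triangle \<open>p' q' r'\<close> in the
  Euclidean plane. Since \<open>p, q, r\<close> are arbitrary, it suffices to compare points on the two sides
  issuing from \<open>p\<close>; points on a common side are compared trivially.\<close>

definition CAT0 :: "'a::metric_space itself \<Rightarrow> bool" where
  "CAT0 _ \<longleftrightarrow>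
     geodesic_space TYPE('a) \<and>
     (\<forall>(p::'a) q r c1 c2 (p'::real^2) q' r' x' y' s t.
        geodesic_from_to c1 p q \<and> geodesic_from_to c2 p r \<and>
        dist p' q' = dist p q \<and> dist p' r' = dist p r \<and> dist q' r' = dist q r \<and>
        s \<in> {0..dist p q} \<and> x' \<in> closed_segment p' q' \<and> dist p' x' = s \<and>
        t \<in> {0..dist p r} \<and> y' \<in> closed_segment p' r' \<and> dist p' y' = t
        \<longrightarrow> dist (c1 s) (c2 t) \<le> dist x' y')"

definition proper_space :: "'a::metric_space itself \<Rightarrow> bool" where
  "proper_space _ \<longleftrightarrow> (\<forall>(x::'a) r. compact (cball x r))"

definition local_geodesic :: "real \<Rightarrow> real \<Rightarrow> (real \<Rightarrow> 'a::metric_space) \<Rightarrow> bool" where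
  "local_geodesic a b c \<longleftrightarrow> (\<forall>t\<in>{a..b}. \<exists>\<epsilon>>0. isometric_on ({a..b} \<inter> ball t \<epsilon>) c)"

definition geodesically_complete :: "'a::metric_space itself \<Rightarrow> bool" where
  "geodesically_complete _ \<longleftrightarrow>
     (\<forall>a b (c :: real \<Rightarrow> 'a). a < b \<and> local_geodesic a b c \<longrightarrow>
        (\<exists>g. isometric_on UNIV g \<and> (\<forall>t\<in>{a..b}. g t = c t)))"

definition geodesic_proj :: "'a::metric_space \<Rightarrow> real \<Rightarrow> 'a \<Rightarrow> 'a" where
  "geodesic_proj x0 s y = (THE z. \<exists>c. geodesic_from_to c x0 y \<and> z = c s)"

text \<open>The inverse limit of the spheres of radius \<open>t > 0\<close> about \<open>x0\<close>, a subspace of their product.\<close>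

definition visual_boundary :: "'a::metric_space \<Rightarrow> (real \<Rightarrow> 'a) topology" where
  "visual_boundary x0 =
     subtopology (product_topology (\<lambda>t. top_of_set (sphere x0 t)) {0<..})
       {f. \<forall>s t. 0 < s \<and> s \<le> t \<longrightarrow> geodesic_proj x0 s (f t) = f s}"

definition sink :: "'a::metric_space set \<Rightarrow> 'a \<Rightarrow> 'a \<Rightarrow> bool" where
  "sink Z x y \<longleftrightarrow>
     x \<in> Z \<and> y \<in> Z \<and> x \<noteq> y \<and>
     (\<forall>\<^sub>F (x', y') in at (x, y) within Z \<times> Z. dist x y \<le> dist x' y')"


section \<open>Semistability at infinity\<close>

definition proper_ray :: "(real \<Rightarrow> 'a::topological_space) \<Rightarrow> bool" where
  "proper_ray r \<longleftrightarrow>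
     continuous_on {0..} r \<and> (\<forall>C. compact C \<longrightarrow> compact ({0..} \<inter> r -` C))"

definition same_end :: "(real \<Rightarrow> 'a::topological_space) \<Rightarrow> (real \<Rightarrow> 'a) \<Rightarrow> bool" where
  "same_end r1 r2 \<longleftrightarrow>
     (\<forall>C. compact C \<longrightarrow>
        (\<exists>N\<ge>0. \<forall>s\<ge>N. \<forall>t\<ge>N. path_component (- C) (r1 s) (r2 t)))"

definition properly_homotopic :: "(real \<Rightarrow> 'a::topological_space) \<Rightarrow> (real \<Rightarrow> 'a) \<Rightarrow> bool" where
  "properly_homotopic r1 r2 \<longleftrightarrow>
     (\<exists>H :: real \<times> real \<Rightarrow> 'a.
        continuous_on ({0..1} \<times> {0..}) H \<and>
        (\<forall>C. compact C \<longrightarrow> compact (({0..1} \<times> {0..}) \<inter> H -` C)) \<and>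
        (\<forall>t\<ge>0. H (0, t) = r1 t \<and> H (1, t) = r2 t))"

definition semistable_at_infinity :: "'a::topological_space itself \<Rightarrow> bool" where
  "semistable_at_infinity _ \<longleftrightarrow>
     (\<forall>r1 r2 :: real \<Rightarrow> 'a.
        proper_ray r1 \<and> proper_ray r2 \<and> same_end r1 r2 \<longrightarrow> properly_homotopic r1 r2)"

end

theory Submission
  imports Defs
begin

text \<open>
  Let \<open>f, g\<close> be rays from \<open>x0\<close>. If \<open>dist (f t) (g t) < \<iota> t\<close>, then in the sphere of radius \<open>t\<close> the pair
  can be moved in small steps, without increasing its distance, until it collapses to a point or
  becomes a sink; a sink is joined by a curve within distance \<open>K\<close>. Hence \<open>f t\<close> and \<open>g t\<close> are
  joined by arbitrarily fine chains in the sphere that are \<open>K\<close>-homotopic to the two-point chain.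
  Extending the points of a chain to rays moves it outwards, and the lower bounds on \<open>\<iota>\<close> allow one to
  refine it again on the way, up to any radius. Since projections towards \<open>x0\<close> contract by the ratio
  of the radii, \<open>K\<close> becomes negligible at a fixed radius, which gives weak chainedness.

  Interpolating chains and their homotopies by geodesics shows that a path outside a large ball of
  radius \<open>T\<close> whose end points lie further out is homotopic, outside the ball of radius \<open>T - K\<close>, to a
  path arbitrarily far out. Two proper rays with the same end are therefore joined by a sequence of
  paths tending to infinity, with consecutive ones bounding strips that also tend to infinity.
\<close>

section \<open>CAT(0) geometry\<close>

text \<open>The increment \<open>\<iota>\<close> may tend to 0, so no step length works for all
  radii; pushing a chain outwards is therefore an induction along the half-line of radii, not a
  sequence of equal steps. The refinements do not add up, because the distance of two rays does not
  decrease with the radius: a \<open>K\<close>-homotopy at a larger radius is also one at the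
  starting radius. Every homotopy is measured there, with the same \<open>K\<close>, and only the
  mesh is measured at the current radius. Geodesics may branch, so a point of a sphere does not
  determine a ray through it. Chains therefore consist of rays compared at one radius at a time, and
  rays that agree at this radius count as coincident. Semistability comes from the same refinement:
  a chain of rays becomes a ladder with the rays as rails and geodesics between neighbours as rungs.
  Passing from chains to paths costs a bounded amount of radius, \<open>K\<close> or 1, and the
  radii are chosen so that these losses do not accumulate.\<close>

lemma comparison_triangle_exists:
  fixes a b c :: real
  assumes "0 \<le> a" "0 \<le> b" "0 \<le> c" "a \<le> b + c" "b \<le> a + c" "c \<le> a + b"
  obtains q r :: "real^2" where "norm q = a" "norm r = b" "dist q r = c"
proof (cases "a = 0")
  case True
  have n: "norm (vector [b, 0] :: real^2) = b"
    using assms by (simp add: norm_vec_def L2_set_def sum_2)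
  have "b = c" using assms True by simp
  then show ?thesis
    using that[of 0 "vector [b, 0]"] True n by (simp add: dist_norm)
next
  case False
  \<comment> \<open>The law of cosines gives the first coordinate of \<open>r\<close> when
    \<open>q\<close> lies on the first axis; the triangle inequalities bound it by \<open>b\<close>,
    which leaves a real second coordinate.\<close>
  define x where "x = (a\<^sup>2 + b\<^sup>2 - c\<^sup>2) / (2 * a)"
  have ax: "2 * a * x = a\<^sup>2 + b\<^sup>2 - c\<^sup>2"
    using False by (simp add: x_def)
  have "\<bar>a\<^sup>2 + b\<^sup>2 - c\<^sup>2\<bar> \<le> 2 * a * b"
  proof -
    have "(a - b)\<^sup>2 \<le> c\<^sup>2"
      using assms by (intro abs_le_square_iff[THEN iffD1]) auto
    moreover have "c\<^sup>2 \<le> (a + b)\<^sup>2"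
      using assms by (intro power_mono) auto
    ultimately show ?thesis
      by (simp add: power2_eq_square algebra_simps abs_le_iff)
  qed
  then have "\<bar>2 * a * x\<bar> \<le> 2 * a * b" by (simp add: ax)
  then have "\<bar>x\<bar> \<le> b"
    using False assms by (simp add: abs_mult)
  then have "x\<^sup>2 \<le> b\<^sup>2"
    using abs_le_square_iff by fastforce
  define y where "y = sqrt (b\<^sup>2 - x\<^sup>2)"
  have y: "y\<^sup>2 = b\<^sup>2 - x\<^sup>2"
    using \<open>x\<^sup>2 \<le> b\<^sup>2\<close> by (simp add: y_def)
  let ?q = "vector [a, 0] :: real^2" and ?r = "vector [x, y] :: real^2"
  have "norm ?q = a" "norm ?r = b"
    using assms y by (simp_all add: norm_vec_def L2_set_def sum_2)
  moreover have "dist ?q ?r = sqrt ((a - x)\<^sup>2 + y\<^sup>2)"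
    by (simp add: dist_norm norm_vec_def L2_set_def sum_2)
  moreover have "(a - x)\<^sup>2 + y\<^sup>2 = c\<^sup>2"
    using y ax by (simp add: power2_eq_square algebra_simps)
  ultimately show ?thesis
    using that[of ?q ?r] assms by simp
qed

lemma isometric_on_subset: "isometric_on I c \<Longrightarrow> J \<subseteq> I \<Longrightarrow> isometric_on J c"
  unfolding isometric_on_def by blast

text \<open>The parameter is the fraction of the length, so that this is a path on [0,1] and
  geodesics of different lengths can be compared at equal fractions. In a CAT(0) space the choice
  made by \<open>SOME\<close> does not affect the values on [0,1].\<close>

definition geod :: "'a::metric_space \<Rightarrow> 'a \<Rightarrow> real \<Rightarrow> 'a" where
  "geod x y s = (SOME c. geodesic_from_to c x y) (s * dist x y)"

locale cat0 =
  fixes x0 :: "'a::metric_space"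
  assumes cat0: "CAT0 TYPE('a)"
begin

lemma geodesic_some: "geodesic_from_to (SOME c. geodesic_from_to c x y) x (y::'a)"
proof -
  have "\<exists>c. geodesic_from_to c x y"
    using cat0 unfolding CAT0_def geodesic_space_def by blast
  then show ?thesis by (rule someI_ex)
qed

lemma geod_0 [simp]: "geod x (y::'a) 0 = x"
  and geod_1 [simp]: "geod x (y::'a) 1 = y"
  using geodesic_some[of x y] by (simp_all add: geod_def geodesic_from_to_def)

lemma dist_geod:
  fixes x y :: 'a
  assumes "s \<in> {0..1}" "u \<in> {0..1}"
  shows "dist (geod x y s) (geod x y u) = \<bar>s - u\<bar> * dist x y"
proof -
  have "s * dist x y \<in> {0..dist x y}" "u * dist x y \<in> {0..dist x y}"
    using assms by (auto intro: mult_left_le_one_le)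
  then have "dist (geod x y s) (geod x y u) = \<bar>s * dist x y - u * dist x y\<bar>"
    using geodesic_some[of x y] unfolding geod_def geodesic_from_to_def isometric_on_def by blast
  also have "\<dots> = \<bar>s - u\<bar> * dist x y"
    by (simp add: abs_mult flip: left_diff_distrib)
  finally show ?thesis .
qed

text \<open>At equal fractions the comparison points cut off a triangle similar to the whole
  comparison triangle, with ratio \<open>s\<close>.\<close>

lemma cat0_fraction:
  fixes p q r :: 'a
  assumes "geodesic_from_to c1 p q" "geodesic_from_to c2 p r" "s \<in> {0..1}"
  shows "dist (c1 (s * dist p q)) (c2 (s * dist p r)) \<le> s * dist q r"
proof -
  obtain q' r' :: "real^2" where *: "norm q' = dist p q" "norm r' = dist p r" "dist q' r' = dist q r"
  proof (rule comparison_triangle_exists[of "dist p q" "dist p r" "dist q r"])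
    show "dist p q \<le> dist p r + dist q r" by (metis dist_commute dist_triangle)
    show "dist p r \<le> dist p q + dist q r" by (rule dist_triangle)
    show "dist q r \<le> dist p q + dist p r" by (metis dist_commute dist_triangle)
  qed auto
  have "dist (c1 (s * dist p q)) (c2 (s * dist p r)) \<le> dist (s *\<^sub>R q') (s *\<^sub>R r')"
  proof (rule cat0[unfolded CAT0_def, THEN conjunct2, rule_format])
    have "s * dist p q \<in> {0..dist p q}" "s * dist p r \<in> {0..dist p r}"
      using assms by (auto intro: mult_left_le_one_le)
    moreover have "s *\<^sub>R q' \<in> closed_segment 0 q'" "s *\<^sub>R r' \<in> closed_segment 0 r'"
      using assms(3) by (auto simp: in_segment)
    ultimately show "geodesic_from_to c1 p q \<and> geodesic_from_to c2 p r \<and>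
        dist 0 q' = dist p q \<and> dist 0 r' = dist p r \<and> dist q' r' = dist q r \<and>
        s * dist p q \<in> {0..dist p q} \<and> s *\<^sub>R q' \<in> closed_segment 0 q' \<and>
        dist 0 (s *\<^sub>R q') = s * dist p q \<and>
        s * dist p r \<in> {0..dist p r} \<and> s *\<^sub>R r' \<in> closed_segment 0 r' \<and>
        dist 0 (s *\<^sub>R r') = s * dist p r"
      using assms * by simp
  qed
  also have "\<dots> = s * dist q r"
    using assms(3) * by (simp add: dist_norm flip: scaleR_right_diff_distrib)
  finally show ?thesis .
qed

text \<open>This is \<open>cat0_fraction\<close> for a degenerate triangle with
  \<open>q = r\<close>, where the bound is 0.\<close>

lemma geod_unique:
  fixes x y :: 'a
  assumes "geodesic_from_to c x y" "s \<in> {0..1}"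
  shows "c (s * dist x y) = geod x y s"
  using cat0_fraction[OF assms(1) geodesic_some[of x y] assms(2)] by (simp add: geod_def)

lemma geod_rev:
  fixes x y :: 'a
  assumes "s \<in> {0..1}"
  shows "geod x y s = geod y x (1 - s)"
proof -
  let ?c = "SOME c. geodesic_from_to c x y"
  let ?c' = "\<lambda>t. ?c (dist x y - t)"
  have g: "geodesic_from_to ?c x y" by (rule geodesic_some)
  have "isometric_on {0..dist x y} ?c'"
    unfolding isometric_on_def
  proof (intro ballI)
    fix s t assume "s \<in> {0..dist x y}" "t \<in> {0..dist x y}"
    then have "dist x y - s \<in> {0..dist x y}" "dist x y - t \<in> {0..dist x y}" by auto
    then have "dist (?c' s) (?c' t) = \<bar>(dist x y - s) - (dist x y - t)\<bar>"
      using g unfolding geodesic_from_to_def isometric_on_def by blast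
    then show "dist (?c' s) (?c' t) = \<bar>s - t\<bar>" by simp
  qed
  then have "geodesic_from_to ?c' y x"
    using g unfolding geodesic_from_to_def by (simp add: dist_commute)
  from geod_unique[OF this, of "1 - s"] assms show ?thesis
    by (simp add: geod_def dist_commute algebra_simps)
qed

lemma dist_geod_same_start:
  fixes x y z :: 'a
  assumes "s \<in> {0..1}"
  shows "dist (geod x y s) (geod x z s) \<le> s * dist y z"
  using cat0_fraction[OF geodesic_some geodesic_some assms] by (simp add: geod_def)

text \<open>Convexity of the metric: pass through the diagonal geodesic from \<open>x\<close> to
  \<open>y'\<close>, which shares its start with one geodesic and its end with the other.\<close>

lemma dist_geod_geod:
  fixes x y :: 'a
  assumes "s \<in> {0..1}"
  shows "dist (geod x y s) (geod x' y' s) \<le> (1 - s) * dist x x' + s * dist y y'"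
proof -
  have "dist (geod x y s) (geod x' y' s)
      \<le> dist (geod x y s) (geod x y' s) + dist (geod x y' s) (geod x' y' s)"
    by (rule dist_triangle)
  moreover have "dist (geod x y s) (geod x y' s) \<le> s * dist y y'"
    using assms by (rule dist_geod_same_start)
  moreover have "dist (geod x y' s) (geod x' y' s) \<le> (1 - s) * dist x x'"
    using assms dist_geod_same_start[of "1 - s" y' x x'] by (simp add: geod_rev[of s])
  ultimately show ?thesis by simp
qed

lemma geod_same [simp]: "s \<in> {0..1} \<Longrightarrow> geod x x s = (x::'a)"
  using dist_geod[of s 0 x x] by simp

lemma dist_point_geod:
  fixes p x y :: 'a
  assumes "s \<in> {0..1}"
  shows "dist p (geod x y s) \<le> (1 - s) * dist p x + s * dist p y"
  using dist_geod_geod[OF assms, of p p x y] assms by simp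

lemma geod_in_cball:
  fixes p x y :: 'a
  assumes "s \<in> {0..1}" "dist p x \<le> R" "dist p y \<le> R"
  shows "dist p (geod x y s) \<le> R"
proof -
  have "dist p (geod x y s) \<le> (1 - s) * dist p x + s * dist p y"
    by (rule dist_point_geod[OF assms(1)])
  also have "\<dots> \<le> (1 - s) * R + s * R"
    using assms by (intro add_mono mult_left_mono) auto
  finally show ?thesis by (simp add: algebra_simps)
qed

lemma continuous_on_geod:
  fixes f g :: "'b::topological_space \<Rightarrow> 'a"
  assumes f: "continuous_on A f" and g: "continuous_on A g" and h: "continuous_on A h"
    and h01: "h ` A \<subseteq> {0..1}"
  shows "continuous_on A (\<lambda>z. geod (f z) (g z) (h z))"
  unfolding continuous_on_def
proof
  fix a assume a: "a \<in> A"
  \<comment> \<open>The first two terms bound the change of the end points at a fixed parameter, by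
    convexity; the last is the distance travelled along the geodesic belonging to
    \<open>a\<close>.\<close>
  let ?B = "\<lambda>z. dist (f z) (f a) + dist (g z) (g a) + \<bar>h z - h a\<bar> * dist (f a) (g a)"
  have "((\<lambda>z. dist (geod (f z) (g z) (h z)) (geod (f a) (g a) (h a))) \<longlongrightarrow> 0) (at a within A)"
  proof (rule tendsto_sandwich[OF _ _ tendsto_const])
    show "\<forall>\<^sub>F z in at a within A. dist (geod (f z) (g z) (h z)) (geod (f a) (g a) (h a)) \<le> ?B z"
      unfolding eventually_at_filter
    proof (intro always_eventually allI impI)
      fix z assume "z \<in> A"
      then have hz: "h z \<in> {0..1}" "h a \<in> {0..1}" using h01 a by auto
      have "dist (geod (f z) (g z) (h z)) (geod (f a) (g a) (h z))
          \<le> (1 - h z) * dist (f z) (f a) + h z * dist (g z) (g a)"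
        using dist_geod_geod[OF hz(1)] .
      also have "\<dots> \<le> 1 * dist (f z) (f a) + 1 * dist (g z) (g a)"
        using hz by (intro add_mono mult_right_mono) auto
      finally have "dist (geod (f z) (g z) (h z)) (geod (f a) (g a) (h z))
          \<le> dist (f z) (f a) + dist (g z) (g a)" by simp
      moreover have "dist (geod (f a) (g a) (h z)) (geod (f a) (g a) (h a))
          = \<bar>h z - h a\<bar> * dist (f a) (g a)"
        by (rule dist_geod[OF hz])
      ultimately show "dist (geod (f z) (g z) (h z)) (geod (f a) (g a) (h a)) \<le> ?B z"
        using dist_triangle[of "geod (f z) (g z) (h z)" "geod (f a) (g a) (h a)" "geod (f a) (g a) (h z)"]
        by linarith
    qed
    have "(f \<longlongrightarrow> f a) (at a within A)" "(g \<longlongrightarrow> g a) (at a within A)" "(h \<longlongrightarrow> h a) (at a within A)"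
      using f g h a unfolding continuous_on_def by auto
    then have "(?B \<longlongrightarrow> dist (f a) (f a) + dist (g a) (g a) + \<bar>h a - h a\<bar> * dist (f a) (g a)) (at a within A)"
      by (intro tendsto_intros)
    then show "(?B \<longlongrightarrow> 0) (at a within A)" by simp
  qed auto
  then show "((\<lambda>z. geod (f z) (g z) (h z)) \<longlongrightarrow> geod (f a) (g a) (h a)) (at a within A)"
    by (simp add: tendsto_dist_iff[of _ "geod (f a) (g a) (h a)"])
qed

lemma path_geod: "path (geod x (y::'a))"
  unfolding path_def by (intro continuous_on_geod continuous_intros) auto

lemma pathstart_geod [simp]: "pathstart (geod x (y::'a)) = x"
  and pathfinish_geod [simp]: "pathfinish (geod x (y::'a)) = y"
  by (simp_all add: pathstart_def pathfinish_def)

end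

section \<open>Chains and their homotopies\<close>

lemma eps_chain_Nil [simp]: "\<not> eps_chain M d \<epsilon> []"
  by (simp add: eps_chain_def)

lemma eps_chain_single [simp]: "eps_chain M d \<epsilon> [x] \<longleftrightarrow> x \<in> M"
  by (simp add: eps_chain_def)

lemma eps_chain_Cons_Cons [simp]:
  "eps_chain M d \<epsilon> (x # y # zs) \<longleftrightarrow> x \<in> M \<and> d x y < \<epsilon> \<and> eps_chain M d \<epsilon> (y # zs)"
proof -
  have split: "(\<forall>i. P i) \<longleftrightarrow> P 0 \<and> (\<forall>i. P (Suc i))" for P
    by (metis nat.exhaust)
  have "(\<forall>i. Suc i < length (x # y # zs) \<longrightarrow> d ((x # y # zs) ! i) ((x # y # zs) ! Suc i) < \<epsilon>)
    \<longleftrightarrow> d x y < \<epsilon> \<and> (\<forall>i. Suc i < length (y # zs) \<longrightarrow> d ((y # zs) ! i) ((y # zs) ! Suc i) < \<epsilon>)"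
    (is "(\<forall>i. ?P i) \<longleftrightarrow> _")
    by (subst split[of ?P]) simp
  then show ?thesis
    unfolding eps_chain_def by auto
qed

lemma eps_chain_append:
  assumes "xs \<noteq> []" "ys \<noteq> []"
  shows "eps_chain M d \<epsilon> (xs @ ys) \<longleftrightarrow>
    eps_chain M d \<epsilon> xs \<and> eps_chain M d \<epsilon> ys \<and> d (last xs) (hd ys) < \<epsilon>"
  using assms(1)
proof (induction xs rule: list_nonempty_induct)
  case (single x)
  then show ?case using assms(2) by (cases ys) auto
next
  case (cons x xs)
  then show ?case by (cases xs) auto
qed

lemma eps_chain_append_tail:
  assumes "eps_chain M d \<epsilon> xs" "eps_chain M d \<epsilon> (last xs # vs)"
  shows "eps_chain M d \<epsilon> (xs @ vs)"
proof (cases "vs = []")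
  case False
  moreover have "xs \<noteq> []" using assms(1) by auto
  ultimately show ?thesis
    using assms by (cases vs) (auto simp: eps_chain_append)
qed (use assms in simp)

lemma eps_chain_set: "eps_chain M d \<epsilon> xs \<Longrightarrow> set xs \<subseteq> M"
  by (simp add: eps_chain_def)

lemma eps_chain_nonempty: "eps_chain M d \<epsilon> xs \<Longrightarrow> xs \<noteq> []"
  by (simp add: eps_chain_def)

lemma inserts_point_ends:
  assumes "inserts_point xs ys"
  shows "hd xs = hd ys" "last xs = last ys"
  using assms unfolding inserts_point_def by auto

lemma inserts_point_append_right: "inserts_point xs ys \<Longrightarrow> inserts_point (xs @ ws) (ys @ ws)"
  unfolding inserts_point_def
  by (metis append.assoc append_Cons append_is_Nil_conv)

lemma inserts_point_append_left: "inserts_point xs ys \<Longrightarrow> inserts_point (ws @ xs) (ws @ ys)"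
  unfolding inserts_point_def
  by (metis append.assoc append_is_Nil_conv)

lemma eps_step_ends:
  assumes "eps_step M d \<epsilon> xs ys"
  shows "hd xs = hd ys" "last xs = last ys"
  using assms inserts_point_ends unfolding eps_step_def by metis+

lemma eps_homotopic_refl: "eps_chain M d \<epsilon> xs \<Longrightarrow> eps_homotopic M d \<epsilon> xs xs"
  by (simp add: eps_homotopic_def)

lemma eps_homotopic_trans [trans]:
  "eps_homotopic M d \<epsilon> xs ys \<Longrightarrow> eps_homotopic M d \<epsilon> ys zs \<Longrightarrow> eps_homotopic M d \<epsilon> xs zs"
  unfolding eps_homotopic_def by auto

lemma eps_homotopic_step: "eps_step M d \<epsilon> xs ys \<Longrightarrow> eps_homotopic M d \<epsilon> xs ys"
  unfolding eps_homotopic_def eps_step_def by auto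

lemma eps_homotopic_induct [consumes 1, case_names refl step]:
  assumes "eps_homotopic M d \<epsilon> xs ys"
    and "eps_chain M d \<epsilon> xs \<Longrightarrow> P xs"
    and "\<And>ys zs. eps_homotopic M d \<epsilon> xs ys \<Longrightarrow> eps_step M d \<epsilon> ys zs \<Longrightarrow> P ys \<Longrightarrow> P zs"
  shows "P ys"
proof -
  have "(eps_step M d \<epsilon>)\<^sup>*\<^sup>* xs ys" and x: "eps_chain M d \<epsilon> xs"
    using assms(1) unfolding eps_homotopic_def by auto
  then have "P ys \<and> eps_homotopic M d \<epsilon> xs ys"
  proof (induction rule: rtranclp_induct)
    case base
    then show ?case using assms(2) x by (simp add: eps_homotopic_refl)
  next
    case (step y z)
    then show ?case using assms(3) eps_homotopic_trans[OF _ eps_homotopic_step] x by blast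
  qed
  then show ?thesis by simp
qed

text \<open>The condition at the junction mentions only \<open>last xs\<close>, which a homotopy
  keeps fixed, so it serves every intermediate chain.\<close>

lemma eps_homotopic_append_right:
  assumes "eps_homotopic M d \<epsilon> xs ys" "eps_chain M d \<epsilon> (last xs # vs)"
  shows "eps_homotopic M d \<epsilon> (xs @ vs) (ys @ vs)"
proof -
  have "eps_homotopic M d \<epsilon> (xs @ vs) (ys @ vs) \<and> last ys = last xs"
    using assms(1)
  proof (induction rule: eps_homotopic_induct)
    case refl
    then show ?case using assms(2) by (simp add: eps_chain_append_tail eps_homotopic_refl)
  next
    case (step ys zs)
    then have l: "last zs = last ys" using eps_step_ends by metis
    have "eps_step M d \<epsilon> (ys @ vs) (zs @ vs)"
      using step l assms(2) inserts_point_append_right eps_chain_append_tail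
      unfolding eps_step_def by metis
    then show ?case
      using step l by (auto intro: eps_homotopic_trans eps_homotopic_step)
  qed
  then show ?thesis by simp
qed

lemma eps_homotopic_append_left:
  assumes "eps_homotopic M d \<epsilon> xs ys" "eps_chain M d \<epsilon> (us @ [hd xs])"
  shows "eps_homotopic M d \<epsilon> (us @ xs) (us @ ys)"
proof (cases "us = []")
  case False
  have ch: "eps_chain M d \<epsilon> (us @ zs)" if "eps_chain M d \<epsilon> zs" "hd zs = hd xs" for zs
    using that assms(2) False eps_chain_nonempty[OF that(1)] by (simp add: eps_chain_append)
  have "eps_homotopic M d \<epsilon> (us @ xs) (us @ ys) \<and> hd ys = hd xs"
    using assms(1)
  proof (induction rule: eps_homotopic_induct)
    case refl
    then show ?case using ch by (simp add: eps_homotopic_refl)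
  next
    case (step ys zs)
    then have l: "hd zs = hd ys" using eps_step_ends by metis
    have "eps_step M d \<epsilon> (us @ ys) (us @ zs)"
      using step l ch inserts_point_append_left
      unfolding eps_step_def by metis
    then show ?case
      using step l by (auto intro: eps_homotopic_trans eps_homotopic_step)
  qed
  then show ?thesis by simp
qed (use assms in simp)

lemma eps_homotopic_insert:
  assumes "us \<noteq> []" "vs \<noteq> []" "eps_chain M d \<epsilon> (us @ vs)" "eps_chain M d \<epsilon> (us @ z # vs)"
  shows "eps_homotopic M d \<epsilon> (us @ z # vs) (us @ vs)" "eps_homotopic M d \<epsilon> (us @ vs) (us @ z # vs)"
proof -
  have "inserts_point (us @ vs) (us @ z # vs)"
    using assms unfolding inserts_point_def by blast
  then show "eps_homotopic M d \<epsilon> (us @ z # vs) (us @ vs)" "eps_homotopic M d \<epsilon> (us @ vs) (us @ z # vs)"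
    using assms by (auto intro!: eps_homotopic_step simp: eps_step_def)
qed

text \<open>Replaces every link by a finer chain. There are three distance functions because links,
  refinements and homotopies will be measured at three different radii.\<close>

lemma eps_chain_refine:
  assumes "eps_chain M d' \<sigma> \<alpha>"
    and step: "\<And>a b. a \<in> M \<Longrightarrow> b \<in> M \<Longrightarrow> d' a b < \<sigma> \<Longrightarrow>
      \<exists>\<beta>. eps_chain M d'' \<tau> \<beta> \<and> hd \<beta> = a \<and> last \<beta> = b \<and> eps_homotopic M d \<epsilon> \<beta> [a, b]"
  shows "\<exists>\<gamma>. eps_chain M d'' \<tau> \<gamma> \<and> hd \<gamma> = hd \<alpha> \<and> last \<gamma> = last \<alpha> \<and> eps_homotopic M d \<epsilon> \<gamma> \<alpha>"
  using eps_chain_nonempty[OF assms(1)] assms(1)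
proof (induction \<alpha> rule: list_nonempty_induct)
  case (single a)
  then show ?case by (intro exI[of _ "[a]"]) (simp add: eps_homotopic_refl)
next
  case (cons a \<alpha>')
  then obtain b rest where \<alpha>': "\<alpha>' = b # rest" by (cases \<alpha>') auto
  then have ab: "a \<in> M" "d' a b < \<sigma>" and ch: "eps_chain M d' \<sigma> (b # rest)"
    using cons.prems by auto
  then have "b \<in> M" using eps_chain_set by fastforce
  obtain \<beta> where \<beta>: "eps_chain M d'' \<tau> \<beta>" "hd \<beta> = a" "last \<beta> = b" "eps_homotopic M d \<epsilon> \<beta> [a, b]"
    using step[OF ab(1) \<open>b \<in> M\<close> ab(2)] by blast
  obtain \<gamma>' where \<gamma>': "eps_chain M d'' \<tau> \<gamma>'" "hd \<gamma>' = b" "last \<gamma>' = last \<alpha>'"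
      "eps_homotopic M d \<epsilon> \<gamma>' \<alpha>'"
    using cons.IH ch \<alpha>' by auto
  then obtain g where g: "\<gamma>' = b # g"
    using eps_chain_nonempty by (cases \<gamma>') auto
  have "\<beta> \<noteq> []" using \<beta>(1) by auto
  have "eps_chain M d'' \<tau> (\<beta> @ g)"
    using \<beta> \<gamma>' g eps_chain_append_tail by metis
  moreover have "hd (\<beta> @ g) = a" using \<beta> \<open>\<beta> \<noteq> []\<close> by simp
  moreover have "last (\<beta> @ g) = last (a # \<alpha>')"
    using \<beta> \<gamma>' g \<alpha>' by (cases g) auto
  moreover have "eps_homotopic M d \<epsilon> (\<beta> @ g) (a # \<alpha>')"
  proof -
    have "eps_homotopic M d \<epsilon> (\<beta> @ g) ([a, b] @ g)"
      using \<beta> \<gamma>' g by (intro eps_homotopic_append_right) (simp_all add: eps_homotopic_def)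
    moreover have "eps_homotopic M d \<epsilon> ([a] @ \<gamma>') ([a] @ \<alpha>')"
      using \<gamma>' g \<beta> by (intro eps_homotopic_append_left) (simp_all add: eps_homotopic_def)
    ultimately show ?thesis
      using g eps_homotopic_trans by auto
  qed
  ultimately show ?case by (metis list.sel(1))
qed

lemma eps_homotopic_star:
  assumes "eps_chain M d \<epsilon> (f # zs @ [g])" "\<And>z. z \<in> set zs \<Longrightarrow> d f z < \<epsilon>" "d f g < \<epsilon>"
  shows "eps_homotopic M d \<epsilon> (f # zs @ [g]) [f, g]"
  using assms
proof (induction zs)
  case Nil
  then show ?case by (simp add: eps_homotopic_refl)
next
  case (Cons z zs)
  have ch: "eps_chain M d \<epsilon> (f # zs @ [g])"
  proof (cases zs)
    case Nil
    then show ?thesis using Cons.prems by auto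
  next
    case (Cons w ws)
    then show ?thesis using Cons.prems by auto
  qed
  have "eps_homotopic M d \<epsilon> ([f] @ z # (zs @ [g])) ([f] @ (zs @ [g]))"
    using Cons.prems ch by (intro eps_homotopic_insert) auto
  moreover have "eps_homotopic M d \<epsilon> (f # zs @ [g]) [f, g]"
    using Cons ch by auto
  ultimately show ?case
    using eps_homotopic_trans by fastforce
qed

text \<open>Contract \<open>\<alpha>\<close> to its end points, then drop \<open>g'\<close>, then
  \<open>f'\<close>. Between the two drops the diagonal from \<open>f'\<close> to \<open>g\<close>
  is a link, which is why its length is bounded.\<close>

lemma eps_homotopic_trapezium:
  assumes "eps_homotopic M d \<epsilon> \<alpha> [f', g']" "hd \<alpha> = f'" "last \<alpha> = g'" "f \<in> M" "g \<in> M"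
    and "d f f' < \<epsilon>" "d f' g < \<epsilon>" "d g' g < \<epsilon>" "d f g < \<epsilon>"
  shows "eps_homotopic M d \<epsilon> (f # \<alpha> @ [g]) [f, g]"
proof -
  have M: "f' \<in> M" "g' \<in> M" "d f' g' < \<epsilon>"
    using assms(1) by (auto simp: eps_homotopic_def)
  have "\<alpha> \<noteq> []"
    using assms(1) by (auto simp: eps_homotopic_def)
  have 1: "eps_homotopic M d \<epsilon> (\<alpha> @ [g]) ([f', g'] @ [g])"
    using assms M by (intro eps_homotopic_append_right) auto
  have "eps_homotopic M d \<epsilon> ([f] @ (\<alpha> @ [g])) ([f] @ ([f', g'] @ [g]))"
    using assms M \<open>\<alpha> \<noteq> []\<close> by (intro eps_homotopic_append_left 1) auto
  also have "eps_homotopic M d \<epsilon> ([f] @ ([f', g'] @ [g])) ([f, f'] @ [g])"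
    using eps_homotopic_insert(1)[of "[f, f']" "[g]" M d \<epsilon> g'] assms M by simp
  also have "eps_homotopic M d \<epsilon> ([f, f'] @ [g]) ([f] @ [g])"
    using eps_homotopic_insert(1)[of "[f]" "[g]" M d \<epsilon> f'] assms M by simp
  finally show ?thesis by simp
qed

text \<open>The points reachable from \<open>x\<close> by chains of a fixed mesh form an open set
  whose complement is also open.\<close>

lemma chain_connected_connected_space:
  assumes "Metric_space M d" and conn: "connected_space (Metric_space.mtopology M d)"
  shows "chain_connected M d"
  unfolding chain_connected_def
proof (intro ballI allI impI)
  interpret Metric_space M d by fact
  fix x y and \<epsilon> :: real assume xy: "x \<in> M" "y \<in> M" and "\<epsilon> > 0"
  let ?R = "\<lambda>y. \<exists>xs. eps_chain M d \<epsilon> xs \<and> hd xs = x \<and> last xs = y"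
  have ext: "?R v" if "?R u" "u \<in> M" "v \<in> M" "d u v < \<epsilon>" for u v
  proof -
    from \<open>?R u\<close> obtain xs where "eps_chain M d \<epsilon> xs" "hd xs = x" "last xs = u" by blast
    then have "eps_chain M d \<epsilon> (xs @ [v])" "hd (xs @ [v]) = x" "last (xs @ [v]) = v"
      using that eps_chain_nonempty[of M d \<epsilon> xs] by (simp_all add: eps_chain_append)
    then show ?thesis by blast
  qed
  define A where "A = {y \<in> M. ?R y}"
  have "openin mtopology A"
    unfolding openin_mtopology
  proof (intro conjI allI impI)
    fix u assume "u \<in> A"
    then have "v \<in> A" if "v \<in> mball u \<epsilon>" for v
      using ext[of u v] that by (simp add: A_def)
    then have "mball u \<epsilon> \<subseteq> A" by blast
    then show "\<exists>r>0. mball u r \<subseteq> A" using \<open>\<epsilon> > 0\<close> by blast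
  qed (auto simp: A_def)
  moreover have "openin mtopology (M - A)"
    unfolding openin_mtopology
  proof (intro conjI allI impI)
    fix u assume u: "u \<in> M - A"
    have "mball u \<epsilon> \<subseteq> M - A"
    proof
      fix v assume v: "v \<in> mball u \<epsilon>"
      then have "v \<notin> A" using ext[of v u] u commute by (auto simp: A_def)
      then show "v \<in> M - A" using v by auto
    qed
    then show "\<exists>r>0. mball u r \<subseteq> M - A" using \<open>\<epsilon> > 0\<close> by blast
  qed auto
  then have "closedin mtopology A"
    by (auto simp: closedin_def A_def)
  ultimately have "A = {} \<or> A = M"
    using conn unfolding connected_space_clopen_in by auto
  moreover have "x \<in> A"
    using xy by (auto simp: A_def intro!: exI[of _ "[x]"])
  ultimately show "?R y" using xy by (auto simp: A_def)
qed

section \<open>The boundary as a space of rays\<close>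

locale complete_cat0 = cat0 x0 for x0 :: "'a::metric_space" +
  assumes proper: "proper_space TYPE('a)"
    and complete: "geodesically_complete TYPE('a)"
begin

definition rays :: "(real \<Rightarrow> 'a) set" where
  "rays = topspace (visual_boundary x0)"

lemma geodesic_proj_eq:
  assumes "0 < s" "s \<le> dist x0 y"
  shows "geodesic_proj x0 s y = geod x0 y (s / dist x0 y)"
proof -
  have s: "s / dist x0 y \<in> {0..1}" "s / dist x0 y * dist x0 y = s"
    using assms by (auto simp: divide_simps)
  show ?thesis
    unfolding geodesic_proj_def
  proof (rule the_equality)
    show "\<exists>c. geodesic_from_to c x0 y \<and> geod x0 y (s / dist x0 y) = c s"
      using geodesic_some[of x0 y] s by (auto simp: geod_def)
  next
    fix z assume "\<exists>c. geodesic_from_to c x0 y \<and> z = c s"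
    then show "z = geod x0 y (s / dist x0 y)"
      using geod_unique[OF _ s(1)] s(2) by auto
  qed
qed

lemma rays_iff:
  "f \<in> rays \<longleftrightarrow> f \<in> extensional {0<..} \<and> (\<forall>t>0. dist x0 (f t) = t) \<and>
     (\<forall>s t. 0 < s \<and> s \<le> t \<longrightarrow> geod x0 (f t) (s / t) = f s)"
proof -
  have "f \<in> rays \<longleftrightarrow> f \<in> extensional {0<..} \<and> (\<forall>t>0. dist x0 (f t) = t) \<and>
     (\<forall>s t. 0 < s \<and> s \<le> t \<longrightarrow> geodesic_proj x0 s (f t) = f s)"
    by (auto simp: rays_def visual_boundary_def PiE_def Pi_def)
  also have "\<dots> \<longleftrightarrow> f \<in> extensional {0<..} \<and> (\<forall>t>0. dist x0 (f t) = t) \<and>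
     (\<forall>s t. 0 < s \<and> s \<le> t \<longrightarrow> geod x0 (f t) (s / t) = f s)"
    by (intro conj_cong refl all_cong) (simp add: geodesic_proj_eq)
  finally show ?thesis .
qed

lemma dist_x0_ray [simp]: "f \<in> rays \<Longrightarrow> 0 < t \<Longrightarrow> dist x0 (f t) = t"
  by (simp add: rays_iff)

lemma ray_geod: "f \<in> rays \<Longrightarrow> 0 < s \<Longrightarrow> s \<le> t \<Longrightarrow> geod x0 (f t) (s / t) = f s"
  by (simp add: rays_iff)

lemma dist_ray_le:
  assumes "f \<in> rays" "0 < s" "s \<le> t"
  shows "dist (f s) (f t) = t - s"
proof -
  have "dist (geod x0 (f t) (s / t)) (geod x0 (f t) 1) = \<bar>s / t - 1\<bar> * dist x0 (f t)"
    using assms by (intro dist_geod) auto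
  also have "geod x0 (f t) (s / t) = f s"
    using assms by (intro ray_geod)
  also have "\<bar>s / t - 1\<bar> * dist x0 (f t) = t - s"
    using assms by (simp add: abs_if field_simps)
  finally show ?thesis by simp
qed

lemma dist_ray:
  assumes "f \<in> rays" "0 < s" "0 < t"
  shows "dist (f s) (f t) = \<bar>s - t\<bar>"
  using dist_ray_le[OF assms(1), of s t] dist_ray_le[OF assms(1), of t s] assms
  by (cases "s \<le> t") (auto simp: dist_commute)

lemma continuous_on_ray:
  assumes "f \<in> rays"
  shows "continuous_on {0<..} f"
  unfolding continuous_on_iff
  using assms by (auto simp: dist_ray dist_real_def)

lemma dist_rays_contract:
  assumes "f \<in> rays" "g \<in> rays" "0 < s" "s \<le> t"
  shows "dist (f s) (g s) \<le> s / t * dist (f t) (g t)"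
  using dist_geod_same_start[of "s / t" x0 "f t" "g t"] assms by (simp add: ray_geod)

lemma dist_rays_mono:
  assumes "f \<in> rays" "g \<in> rays" "0 < s" "s \<le> t"
  shows "dist (f s) (g s) \<le> dist (f t) (g t)"
proof -
  have "dist (f s) (g s) \<le> s / t * dist (f t) (g t)"
    by (rule dist_rays_contract[OF assms])
  also have "\<dots> \<le> 1 * dist (f t) (g t)"
    using assms by (intro mult_right_mono) auto
  finally show ?thesis by simp
qed

lemma dist_rays_expand:
  assumes "f \<in> rays" "g \<in> rays" "0 < s" "s \<le> t"
  shows "dist (f t) (g t) \<le> dist (f s) (g s) + 2 * (t - s)"
proof -
  have "dist (f t) (g t) \<le> dist (f t) (f s) + dist (f s) (g s) + dist (g s) (g t)"
    using dist_triangle[of "f t" "g t" "f s"] dist_triangle[of "f s" "g t" "g s"] by linarith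
  then show ?thesis
    using dist_ray_le[of f s t] dist_ray_le[of g s t] assms by (simp add: dist_commute)
qed

text \<open>Geodesic completeness extends the geodesic from \<open>x0\<close> to \<open>p\<close> to
  a line. The line is isometric globally, so its initial pieces are the unique geodesics from
  \<open>x0\<close> and satisfy the inverse limit condition.\<close>

lemma ray_through:
  assumes "p \<noteq> x0"
  obtains f where "f \<in> rays" "f (dist x0 p) = p"
proof -
  let ?c = "SOME c. geodesic_from_to c x0 p"
  have c: "geodesic_from_to ?c x0 p" by (rule geodesic_some)
  have pos: "0 < dist x0 p" using assms by simp
  have "local_geodesic 0 (dist x0 p) ?c"
    unfolding local_geodesic_def
  proof
    fix t assume "t \<in> {0..dist x0 p}"
    have "isometric_on ({0..dist x0 p} \<inter> ball t 1) ?c"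
      using c unfolding geodesic_from_to_def by (blast intro: isometric_on_subset)
    then show "\<exists>\<epsilon>>0. isometric_on ({0..dist x0 p} \<inter> ball t \<epsilon>) ?c"
      using zero_less_one by blast
  qed
  then obtain g where g: "isometric_on UNIV g" "\<forall>t\<in>{0..dist x0 p}. g t = ?c t"
    using complete pos unfolding geodesically_complete_def by blast
  have g0: "g 0 = x0" and gp: "g (dist x0 p) = p"
    using g(2) c pos by (auto simp: geodesic_from_to_def)
  have dg: "dist x0 (g t) = t" if "t \<ge> 0" for t
    using g(1) that g0 unfolding isometric_on_def by (metis UNIV_I abs_of_nonneg abs_minus_commute diff_zero)
  have "geod x0 (g t) (s / t) = g s" if "0 < s" "s \<le> t" for s t
  proof -
    have "geodesic_from_to g x0 (g t)"
      using g(1) g0 dg[of t] that isometric_on_subset by (auto simp: geodesic_from_to_def)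
    from geod_unique[OF this, of "s / t"] that dg[of t] show ?thesis by simp
  qed
  then have "restrict g {0<..} \<in> rays"
    using dg by (simp add: rays_iff)
  moreover have "restrict g {0<..} (dist x0 p) = p"
    using gp pos by simp
  ultimately show ?thesis using that by blast
qed

lemma compact_sphere: "compact (sphere x0 t)"
proof -
  have "sphere x0 t = cball x0 t \<inter> {y. dist x0 y = t}" by auto
  moreover have "closed {y. dist x0 y = t}"
    by (intro closed_Collect_eq continuous_intros)
  ultimately show ?thesis
    using proper unfolding proper_space_def by (simp add: compact_Int_closed)
qed

text \<open>The product of spheres is compact by Tychonoff, and each condition of the inverse limit
  is the equaliser of two continuous maps into a Hausdorff space, hence closed.\<close>

lemma compact_visual_boundary: "compact_space (visual_boundary x0)"
proof -
  let ?P = "product_topology (\<lambda>t. top_of_set (sphere x0 t)) {0<..}"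
  let ?E = "\<lambda>(s, t). {f \<in> topspace ?P. geodesic_proj x0 s (f t) = f s}"
  let ?I = "{(s, t). 0 < s \<and> s \<le> (t::real)}"
  have "compact_space ?P"
    by (simp add: compact_space_product_topology compact_space_subtopology compact_sphere)
  moreover have "closedin ?P (topspace ?P \<inter> (\<Inter>z\<in>?I. ?E z))"
  proof -
    have "(1, 1) \<in> ?I" by simp
    then have "?I \<noteq> {}" by blast
    have "closedin ?P (?E z)" if "z \<in> ?I" for z :: "real \<times> real"
    proof -
      obtain s t where z: "z = (s, t)" "0 < s" "s \<le> t" using \<open>z \<in> ?I\<close> by (cases z) auto
      have proj: "continuous_map ?P (top_of_set (sphere x0 u)) (\<lambda>f. f u)" if "u > 0" for u
        using that by (intro continuous_map_product_projection) auto
      have "continuous_on (sphere x0 t) (\<lambda>y. geod x0 y (s / t))"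
        using z by (intro continuous_on_geod continuous_intros) auto
      then have "continuous_on (sphere x0 t) (geodesic_proj x0 s)"
        by (rule continuous_on_eq) (use z in \<open>simp add: geodesic_proj_eq\<close>)
      then have "continuous_map ?P euclidean (geodesic_proj x0 s \<circ> (\<lambda>f. f t))"
        using z by (intro continuous_map_compose[OF proj]) auto
      then have 1: "continuous_map ?P euclidean (\<lambda>f. geodesic_proj x0 s (f t))"
        unfolding o_def .
      have 2: "continuous_map ?P euclidean (\<lambda>f. f s)"
        using continuous_map_into_fulltopology[OF proj[of s]] z by blast
      show ?thesis
        using closedin_continuous_maps_eq[OF Hausdorff_space_euclidean 1 2] by (simp only: z prod.case)
    qed
    then have "closedin ?P (\<Inter>z\<in>?I. ?E z)"
      by (rule closedin_INT[OF \<open>?I \<noteq> {}\<close>])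
    then show ?thesis by (rule closedin_Int[OF closedin_topspace])
  qed
  ultimately have compact: "compactin ?P (topspace ?P \<inter> (\<Inter>z\<in>?I. ?E z))"
    by (rule closedin_compact_space)
  have "topspace ?P \<inter> (\<Inter>z\<in>?I. ?E z) =
      topspace ?P \<inter> {f. \<forall>s t. 0 < s \<and> s \<le> t \<longrightarrow> geodesic_proj x0 s (f t) = f s}" (is "?L = ?R")
  proof (rule set_eqI)
    fix f
    have "f \<in> (\<Inter>z\<in>?I. ?E z) \<longleftrightarrow>
        f \<in> {f. \<forall>s t. 0 < s \<and> s \<le> t \<longrightarrow> geodesic_proj x0 s (f t) = f s}"
      if "f \<in> topspace ?P"
      using that by (simp only: INT_iff mem_Collect_eq prod.case Ball_def split_paired_All simp_thms)
    then show "f \<in> ?L \<longleftrightarrow> f \<in> ?R" by blast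
  qed
  then have "visual_boundary x0 = subtopology ?P (topspace ?P \<inter> (\<Inter>z\<in>?I. ?E z))"
    unfolding visual_boundary_def by (simp only: subtopology_restrict)
  then show ?thesis
    using compact_space_subtopology[OF compact] by (simp only:)
qed

text \<open>\<open>dist (f t) (g t)\<close> increases and \<open>1/t\<close> decreases in \<open>t\<close>, so this metric compares \<open>f\<close> and \<open>g\<close>
  near the radius where the two cross.\<close>

definition ray_dist :: "(real \<Rightarrow> 'a) \<Rightarrow> (real \<Rightarrow> 'a) \<Rightarrow> real" where
  "ray_dist f g = (SUP t\<in>{1..}. min (dist (f t) (g t)) (1 / t))"

lemma ray_dist_upper:
  assumes "1 \<le> t"
  shows "min (dist (f t) (g t)) (1 / t) \<le> ray_dist f g"
proof -
  have "bdd_above ((\<lambda>t. min (dist (f t) (g t)) (1 / t)) ` {1..})"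
    by (intro bdd_aboveI2[of _ _ 1]) (auto simp: min_le_iff_disj)
  then show ?thesis
    unfolding ray_dist_def using assms by (intro cSUP_upper) auto
qed

text \<open>One radius controls the whole supremum: below \<open>t\<close> the distance of the rays
  is smaller than at \<open>t\<close>, above \<open>t\<close> the cut-off \<open>1 / s\<close> is
  smaller than \<open>1 / t\<close>.\<close>

lemma ray_dist_le:
  assumes "f \<in> rays" "g \<in> rays" "0 < t" "dist (f t) (g t) \<le> e" "1 / t \<le> e"
  shows "ray_dist f g \<le> e"
  unfolding ray_dist_def
proof (rule cSUP_least)
  fix s :: real assume s: "s \<in> {1..}"
  show "min (dist (f s) (g s)) (1 / s) \<le> e"
  proof (cases "s \<le> t")
    case True
    then show ?thesis using dist_rays_mono[of f g s t] assms s by auto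
  next
    case False
    then have "1 / s \<le> 1 / t" using assms s by (simp add: frac_le)
    then show ?thesis using assms by auto
  qed
qed auto

text \<open>The bound by \<open>1 / max 1 t\<close> rules out that the minimum at this radius is the
  cut-off. The maximum with 1 is there because the supremum starts at radius 1.\<close>

lemma dist_less_ray_dist:
  assumes "f \<in> rays" "g \<in> rays" "0 < t" "ray_dist f g < min e (1 / max 1 t)"
  shows "dist (f t) (g t) < e"
proof -
  have "dist (f (max 1 t)) (g (max 1 t)) < e"
    using ray_dist_upper[of "max 1 t" f g] assms(4) by auto
  then show ?thesis
    using dist_rays_mono[OF assms(1-3), of "max 1 t"] by simp
qed

lemma Metric_space_rays: "Metric_space rays ray_dist"
proof
  fix f g h :: "real \<Rightarrow> 'a"
  show "ray_dist f g = ray_dist g f"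
    by (simp add: ray_dist_def dist_commute)
  show "0 \<le> ray_dist f g"
    using ray_dist_upper[of 1 f g] by (smt (verit) div_by_1 zero_le_dist)
  show "ray_dist f g = 0 \<longleftrightarrow> f = g" if fg: "f \<in> rays" "g \<in> rays"
  proof
    assume *: "ray_dist f g = 0"
    show "f = g"
    proof (rule extensionalityI[of _ "{0<..}"])
      fix t :: real assume "t \<in> {0<..}"
      then have "dist (f t) (g t) < e" if "e > 0" for e
        using that * fg by (intro dist_less_ray_dist[of f g t e]) auto
      then show "f t = g t" by (metis less_irrefl zero_less_dist_iff)
    qed (use fg in \<open>auto simp: rays_iff\<close>)
  next
    assume "f = g"
    have "ray_dist f g = (SUP t\<in>{1::real..}. 0)"
      unfolding ray_dist_def \<open>f = g\<close> by (intro SUP_cong) auto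
    then show "ray_dist f g = 0" by simp
  qed
  show "ray_dist f h \<le> ray_dist f g + ray_dist g h" if "f \<in> rays" "g \<in> rays" "h \<in> rays"
  proof -
    have "min (dist (f t) (h t)) (1 / t) \<le> ray_dist f g + ray_dist g h" if t: "t \<ge> 1" for t
    proof -
      have "dist (f t) (h t) \<le> dist (f t) (g t) + dist (g t) (h t)" by (rule dist_triangle)
      then have "min (dist (f t) (h t)) (1 / t)
          \<le> min (dist (f t) (g t)) (1 / t) + min (dist (g t) (h t)) (1 / t)"
        using t divide_pos_pos[of 1 t] zero_le_dist[of "f t" "g t"] zero_le_dist[of "g t" "h t"]
        by linarith
      also have "\<dots> \<le> ray_dist f g + ray_dist g h"
        using t by (intro add_mono ray_dist_upper)
      finally show ?thesis .
    qed
    then show ?thesis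
      unfolding ray_dist_def[of f h] by (intro cSUP_least) auto
  qed
qed

lemma mtopology_rays: "Metric_space.mtopology rays ray_dist = visual_boundary x0"
proof -
  interpret R: Metric_space rays ray_dist by (rule Metric_space_rays)
  have proj: "continuous_map (visual_boundary x0) euclidean (\<lambda>f. f t)" if "t > 0" for t
  proof -
    have "continuous_map (product_topology (\<lambda>t. top_of_set (sphere x0 t)) {0<..})
        (top_of_set (sphere x0 t)) (\<lambda>f. f t)"
      using that by (intro continuous_map_product_projection) auto
    then show ?thesis
      unfolding visual_boundary_def
      using continuous_map_from_subtopology continuous_map_into_fulltopology by blast
  qed
  have "openin (visual_boundary x0) U" if U: "openin R.mtopology U" for U
  proof (subst openin_subopen, intro ballI)
    fix f assume "f \<in> U"
    then obtain e where e: "e > 0" "R.mball f e \<subseteq> U" and f: "f \<in> rays"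
      using U unfolding R.openin_mtopology by blast
    \<comment> \<open>At this radius the cut-off is \<open>e / 2\<close>, so closeness in this
      single coordinate puts a ray into the metric ball.\<close>
    let ?t = "2 / e"
    let ?V = "{g \<in> topspace (visual_boundary x0). g ?t \<in> ball (f ?t) (e / 2)}"
    have "openin (visual_boundary x0) ?V"
      using e proj[of ?t] by (intro openin_continuous_map_preimage[of _ euclidean]) auto
    moreover have "f \<in> ?V" using f e by (simp add: rays_def)
    moreover have "?V \<subseteq> U"
    proof
      fix g assume "g \<in> ?V"
      then have g: "g \<in> rays" "dist (f ?t) (g ?t) \<le> e / 2" by (auto simp: rays_def)
      have "ray_dist f g \<le> e / 2"
        using g f e by (intro ray_dist_le[of f g ?t]) auto
      then show "g \<in> U" using e f g by (intro subsetD[OF e(2)]) auto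
    qed
    ultimately show "\<exists>T. openin (visual_boundary x0) T \<and> f \<in> T \<and> T \<subseteq> U" by blast
  qed
  moreover have "openin R.mtopology U" if U: "openin (visual_boundary x0) U" for U
  proof -
    have "continuous_map R.mtopology (top_of_set (sphere x0 t)) (\<lambda>f. f t)" if t: "t > 0" for t
      unfolding continuous_map_in_subtopology
    proof
      show "(\<lambda>f. f t) \<in> topspace R.mtopology \<rightarrow> sphere x0 t"
        using t by auto
      show "continuous_map R.mtopology euclidean (\<lambda>f. f t)"
        unfolding continuous_map_def
      proof (intro conjI allI impI)
        fix V :: "'a set" assume "openin euclidean V"
        then have "open V" by simp
        show "openin R.mtopology {f \<in> topspace R.mtopology. f t \<in> V}"
          unfolding R.openin_mtopology
        proof (intro conjI allI impI)
          fix f assume "f \<in> {f \<in> topspace R.mtopology. f t \<in> V}"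
          then have f: "f \<in> rays" "f t \<in> V" by auto
          then obtain e where e: "e > 0" "ball (f t) e \<subseteq> V"
            using \<open>open V\<close> open_contains_ball by blast
          have "R.mball f (min e (1 / max 1 t)) \<subseteq> {f \<in> topspace R.mtopology. f t \<in> V}"
            using e dist_less_ray_dist[OF _ _ t] by auto
          then show "\<exists>r>0. R.mball f r \<subseteq> {f \<in> topspace R.mtopology. f t \<in> V}"
            using e t by (intro exI[of _ "min e (1 / max 1 t)"]) auto
        qed auto
      qed auto
    qed
    then have "continuous_map R.mtopology
        (product_topology (\<lambda>t. top_of_set (sphere x0 t)) {0<..}) id"
      by (auto simp: continuous_map_componentwise rays_iff)
    then have "continuous_map R.mtopology (visual_boundary x0) id"
      unfolding visual_boundary_def continuous_map_in_subtopology
      by (auto simp: rays_iff geodesic_proj_eq)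
    then have "openin R.mtopology {f \<in> topspace R.mtopology. id f \<in> U}"
      using U openin_continuous_map_preimage by blast
    moreover have "{f \<in> topspace R.mtopology. id f \<in> U} = U"
      using openin_subset[OF U] by (auto simp flip: rays_def)
    ultimately show ?thesis by simp
  qed
  ultimately show ?thesis
    by (auto simp: topology_eq)
qed

end

section \<open>Refining chains at infinity\<close>

text \<open>The image of a curve is connected, hence chain connected in itself; this keeps the fine
  chain inside \<open>Z\<close>.\<close>

lemma chain_of_path_component:
  assumes "path_component Z a b" "\<epsilon> > 0"
  obtains xs where "eps_chain Z dist \<epsilon> xs" "hd xs = a" "last xs = b"
proof -
  obtain p where p: "path p" "path_image p \<subseteq> Z" "pathstart p = a" "pathfinish p = b"
    using assms(1) unfolding path_component_def by blast
  let ?W = "path_image p"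
  interpret W: Submetric UNIV dist ?W
    by unfold_locales auto
  have "W.sub.mtopology = top_of_set ?W"
    using W.mtopology_submetric by simp
  moreover have "connectedin euclidean ?W"
    using p(1) connected_path_image by simp
  ultimately have "connected_space W.sub.mtopology"
    by (simp only: connectedin_def)
  then have "chain_connected ?W dist"
    by (rule chain_connected_connected_space[OF W.sub.Metric_space_axioms])
  moreover have "a \<in> ?W" "b \<in> ?W" using p by auto
  ultimately obtain xs where "eps_chain ?W dist \<epsilon> xs" "hd xs = a" "last xs = b"
    using assms(2) unfolding chain_connected_def by blast
  then show ?thesis
    using that p(2) unfolding eps_chain_def by blast
qed

lemma eps_chain_map:
  assumes "eps_chain M d \<epsilon> xs" "\<phi> ` M \<subseteq> M'" "\<And>x y. x \<in> M \<Longrightarrow> y \<in> M \<Longrightarrow> d' (\<phi> x) (\<phi> y) = d x y"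
  shows "eps_chain M' d' \<epsilon> (map \<phi> xs)"
  using assms unfolding eps_chain_def by (auto simp: subset_iff)

text \<open>Only a pseudometric on rays, since rays can agree at radius \<open>t\<close> and branch
  later. The chain predicates accept any distance function.\<close>

abbreviation rdist :: "real \<Rightarrow> (real \<Rightarrow> 'a::metric_space) \<Rightarrow> (real \<Rightarrow> 'a) \<Rightarrow> real" where
  "rdist t f g \<equiv> dist (f t) (g t)"

text \<open>The hypotheses in normalised form. A link shorter than \<open>\<iota> t\<close> is also
  shorter than \<open>K\<close>, and a loss of radius 1 is absorbed by a loss of \<open>K\<close>.
  The limit condition becomes a positive lower bound on a half-open interval that includes
  \<open>t\<close> itself.\<close>

locale refining = complete_cat0 x0 for x0 :: "'a::metric_space" +
  fixes K :: real and \<iota> :: "real \<Rightarrow> real" and T0 :: real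
  assumes K: "1 \<le> K" and T0: "1 \<le> T0"
    and iota_pos: "\<And>t. T0 \<le> t \<Longrightarrow> 0 < \<iota> t"
    and iota_le: "\<And>t. \<iota> t \<le> K"
    and iota_right: "\<And>t. T0 \<le> t \<Longrightarrow> \<exists>c>0. \<exists>\<delta>>0. \<forall>s. t \<le> s \<and> s < t + \<delta> \<longrightarrow> c \<le> \<iota> s"
    and sink_joined: "\<And>t x y. T0 \<le> t \<Longrightarrow> dist x y < \<iota> t \<Longrightarrow> sink (sphere x0 t) x y \<Longrightarrow>
      path_component (sphere x0 t \<inter> ball x K) x y"
begin

text \<open>A relation between rays, not between points of the sphere, so that the ends of the fine
  chain are the prescribed rays even where several rays share a point.\<close>

definition refinable :: "real \<Rightarrow> real \<Rightarrow> (real \<Rightarrow> 'a) \<Rightarrow> (real \<Rightarrow> 'a) \<Rightarrow> bool" where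
  "refinable t \<tau> f g \<longleftrightarrow> (\<exists>\<alpha>. eps_chain rays (rdist t) \<tau> \<alpha> \<and> hd \<alpha> = f \<and> last \<alpha> = g \<and>
     eps_homotopic rays (rdist t) K \<alpha> [f, g])"

lemma ray_above:
  assumes "t > 0" "x \<in> sphere x0 t"
  obtains f where "f \<in> rays" "f t = x"
proof -
  have "x \<noteq> x0" "dist x0 x = t" using assms by auto
  then show ?thesis using ray_through[of x] that by metis
qed

text \<open>A fine chain along the joining curve is lifted to rays. All its points are within
  \<open>K\<close> of \<open>f t\<close>, so it contracts onto its two ends.\<close>

lemma refinable_sink:
  assumes t: "T0 \<le> t" and fg: "f \<in> rays" "g \<in> rays" "rdist t f g < \<iota> t"
    and sink: "sink (sphere x0 t) (f t) (g t)" and "\<tau> > 0"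
  shows "refinable t \<tau> f g"
proof -
  let ?Z = "sphere x0 t \<inter> ball (f t) K"
  have "t > 0" using t T0 by simp
  have ne: "f t \<noteq> g t" using sink by (simp add: sink_def)
  have "path_component ?Z (f t) (g t)"
    by (rule sink_joined[OF t fg(3) sink])
  \<comment> \<open>Mesh \<open>\<tau>\<close> is the one asked for; mesh \<open>K\<close> makes the
    same chain admissible in the homotopy.\<close>
  moreover have "min \<tau> K > 0" using \<open>\<tau> > 0\<close> K by simp
  ultimately obtain xs where xs: "eps_chain ?Z dist (min \<tau> K) xs" "hd xs = f t" "last xs = g t"
    using chain_of_path_component by metis
  define e where "e x = (SOME f. f \<in> rays \<and> f t = x)" for x
  have e: "e x \<in> rays \<and> e x t = x" if "x \<in> sphere x0 t" for x
  proof -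
    have "\<exists>f. f \<in> rays \<and> f t = x"
      using ray_above[OF \<open>t > 0\<close> that] by metis
    from someI_ex[OF this] show ?thesis
      unfolding e_def .
  qed
  \<comment> \<open>The arbitrary choice of rays is overridden at the two ends, where
    \<open>f\<close> and \<open>g\<close> are prescribed; this is consistent because
    \<open>f t\<close> and \<open>g t\<close> differ.\<close>
  define \<phi> where "\<phi> = e(f t := f, g t := g)"
  have \<phi>: "\<phi> x \<in> rays" "\<phi> x t = x" if "x \<in> sphere x0 t" for x
    using e[OF that] fg by (auto simp: \<phi>_def)
  have \<phi>_ends: "\<phi> (f t) = f" "\<phi> (g t) = g"
    using ne by (auto simp: \<phi>_def)
  obtain zs where zs: "xs = f t # zs @ [g t]"
  proof -
    have "xs \<noteq> []" using xs(1) by auto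
    then obtain ys where ys: "xs = f t # ys" using xs(2) by (cases xs) auto
    then have "ys \<noteq> []" using xs(3) ne by auto
    then have "ys = butlast ys @ [g t]" using xs(3) ys by (metis append_butlast_last_id last_ConsR)
    then show ?thesis using ys that by metis
  qed
  have ch: "eps_chain rays (rdist t) (min \<tau> K) (map \<phi> xs)"
    by (rule eps_chain_map[OF xs(1)]) (use \<phi> in auto)
  have "eps_homotopic rays (rdist t) K (f # map \<phi> zs @ [g]) [f, g]"
  proof (rule eps_homotopic_star)
    show "eps_chain rays (rdist t) K (f # map \<phi> zs @ [g])"
      using eps_chain_mono[OF ch, of "rdist t" K] by (simp add: zs \<phi>_ends)
    show "rdist t f g < K" using fg iota_le[of t] by simp
    show "rdist t f z < K" if "z \<in> set (map \<phi> zs)" for z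
    proof -
      obtain w where "w \<in> set zs" "z = \<phi> w"
        using \<open>z \<in> set (map \<phi> zs)\<close> by auto
      moreover from this have "w \<in> ?Z"
        using eps_chain_set[OF xs(1)] zs by fastforce
      ultimately show ?thesis
        using \<phi>(2)[of w] by simp
    qed
  qed
  moreover have "eps_chain rays (rdist t) \<tau> (f # map \<phi> zs @ [g])"
    using eps_chain_mono[OF ch, of "rdist t" \<tau>] by (simp add: zs \<phi>_ends)
  ultimately show ?thesis
    unfolding refinable_def by (intro exI[of _ "f # map \<phi> zs @ [g]"]) auto
qed

text \<open>Take the chain from \<open>f2\<close> to \<open>g2\<close> and add \<open>f1\<close> and
  \<open>g1\<close> at its ends. The last hypothesis bounds the diagonal from \<open>f2\<close> to
  \<open>g1\<close> that occurs in \<open>eps_homotopic_trapezium\<close>.\<close>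

lemma refinable_nearby:
  assumes "f1 \<in> rays" "g1 \<in> rays" "refinable t \<tau> f2 g2"
    and "rdist t f1 f2 < \<tau>" "rdist t g1 g2 < \<tau>"
    and "rdist t f1 f2 < K" "rdist t g1 g2 < K" "rdist t f1 g1 < K" "rdist t f2 g2 + rdist t g1 g2 < K"
  shows "refinable t \<tau> f1 g1"
proof -
  obtain \<alpha> where \<alpha>: "eps_chain rays (rdist t) \<tau> \<alpha>" "hd \<alpha> = f2" "last \<alpha> = g2"
      "eps_homotopic rays (rdist t) K \<alpha> [f2, g2]"
    using assms(3) unfolding refinable_def by blast
  have "\<alpha> \<noteq> []" using \<alpha>(1) by auto
  have "eps_chain rays (rdist t) \<tau> (\<alpha> @ [g1])"
    using \<alpha> \<open>\<alpha> \<noteq> []\<close> assms by (simp add: eps_chain_append dist_commute)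
  then have "eps_chain rays (rdist t) \<tau> ([f1] @ (\<alpha> @ [g1]))"
    using \<alpha> \<open>\<alpha> \<noteq> []\<close> assms by (subst eps_chain_append) auto
  moreover have "rdist t f2 g1 < K"
    using assms(9) dist_triangle[of "f2 t" "g1 t" "g2 t"] by (simp add: dist_commute)
  then have "eps_homotopic rays (rdist t) K (f1 # \<alpha> @ [g1]) [f1, g1]"
    using assms by (intro eps_homotopic_trapezium[OF \<alpha>(4,2,3)]) (auto simp: dist_commute)
  ultimately show ?thesis
    unfolding refinable_def by (intro exI[of _ "f1 # \<alpha> @ [g1]"]) auto
qed

text \<open>Among the pairs at distance at most \<open>rdist t f g\<close> that are not refinable, one at minimal
  distance would be a sink, because a pair that is close to a refinable one is refinable.\<close>

lemma refinable_short:
  assumes t: "T0 \<le> t" and fg: "f \<in> rays" "g \<in> rays" "rdist t f g < \<iota> t" and "\<tau> > 0"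
  shows "refinable t \<tau> f g"
proof (rule ccontr)
  assume bad: "\<not> refinable t \<tau> f g"
  have "t > 0" using t T0 by simp
  let ?S = "sphere x0 t"
  define d0 where "d0 = rdist t f g"
  \<comment> \<open>At most half the gap between \<open>d0\<close> and \<open>K\<close>: the
    diagonal in \<open>refinable_nearby\<close> is bounded by \<open>d0 + \<sigma>\<close>, which
    stays below \<open>K\<close>.\<close>
  define \<sigma> where "\<sigma> = min \<tau> ((K - d0) / 2)"
  have d0: "0 \<le> d0" "d0 < K" "d0 < \<iota> t"
    using fg iota_le[of t] by (auto simp: d0_def)
  then have \<sigma>: "\<sigma> > 0" "\<sigma> \<le> \<tau>" "d0 + \<sigma> < K" "\<sigma> < K"
    using \<open>\<tau> > 0\<close> by (auto simp: \<sigma>_def min_def field_simps)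
  have near: "refinable t \<tau> f1 g1"
    if "f1 \<in> rays" "g1 \<in> rays" "refinable t \<tau> f2 g2" "rdist t f1 f2 < \<sigma>" "rdist t g1 g2 < \<sigma>"
      "rdist t f1 g1 \<le> d0" "rdist t f2 g2 \<le> d0" for f1 g1 f2 g2
    using that \<sigma> by (intro refinable_nearby[of f1 g1 t \<tau> f2 g2]) auto
  \<comment> \<open>One bad choice of rays makes a pair of points bad. By \<open>near\<close>,
    applied to rays that agree at radius \<open>t\<close>, every choice is then bad.\<close>
  define D where "D = {(x, y). x \<in> ?S \<and> y \<in> ?S \<and> dist x y \<le> d0 \<and>
    (\<exists>f\<in>rays. \<exists>g\<in>rays. f t = x \<and> g t = y \<and> \<not> refinable t \<tau> f g)}"
  let ?C = "(?S \<times> ?S) \<inter> {z. dist (fst z) (snd z) \<le> d0}"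
  have "compact ?C"
    by (intro compact_Int_closed compact_Times compact_sphere closed_Collect_le continuous_intros)
  have "D \<subseteq> ?C" by (auto simp: D_def)
  \<comment> \<open>If rays through a limit of bad pairs were refinable, then by \<open>near\<close>
    so would be a bad pair within \<open>\<sigma>\<close> of the limit.\<close>
  have "closed D"
    unfolding closure_subset_eq[symmetric]
  proof
    fix z assume z: "z \<in> closure D"
    then have "z \<in> ?C"
      using closure_minimal[OF \<open>D \<subseteq> ?C\<close>] \<open>compact ?C\<close> compact_imp_closed by blast
    then obtain x y where xy: "z = (x, y)" "x \<in> ?S" "y \<in> ?S" "dist x y \<le> d0"
      by (cases z) auto
    obtain x' y' where xy': "(x', y') \<in> D" "dist (x', y') z < \<sigma>"
      using z \<sigma>(1) unfolding closure_approachable by (metis surj_pair)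
    then have "dist x x' < \<sigma>" "dist y y' < \<sigma>"
      using dist_fst_le[of "(x', y')" z] dist_snd_le[of "(x', y')" z] xy(1) by (auto simp: dist_commute)
    moreover obtain f' g' where "f' \<in> rays" "g' \<in> rays" "f' t = x'" "g' t = y'" "\<not> refinable t \<tau> f' g'"
        "dist x' y' \<le> d0"
      using xy'(1) by (auto simp: D_def)
    moreover obtain f1 where "f1 \<in> rays" "f1 t = x" using ray_above[OF \<open>t > 0\<close> xy(2)] .
    moreover obtain g1 where "g1 \<in> rays" "g1 t = y" using ray_above[OF \<open>t > 0\<close> xy(3)] .
    ultimately have "\<not> refinable t \<tau> f1 g1"
      using near[of f' g' f1 g1] xy(4) by (auto simp: dist_commute)
    then show "z \<in> D"
      using xy \<open>f1 \<in> rays\<close> \<open>f1 t = x\<close> \<open>g1 \<in> rays\<close> \<open>g1 t = y\<close> by (auto simp: D_def)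
  qed
  then have "compact D"
    using \<open>D \<subseteq> ?C\<close> \<open>compact ?C\<close> by (metis compact_Int_closed inf.absorb_iff2)
  moreover have "(f t, g t) \<in> D"
    using fg bad \<open>t > 0\<close> by (auto simp: D_def d0_def)
  moreover have "continuous_on D (\<lambda>z. dist (fst z) (snd z))"
    by (intro continuous_intros)
  ultimately obtain z where z: "z \<in> D" "\<And>w. w \<in> D \<Longrightarrow> dist (fst z) (snd z) \<le> dist (fst w) (snd w)"
    using continuous_attains_inf[of D "\<lambda>z. dist (fst z) (snd z)"] by blast
  have "\<exists>f\<in>rays. \<exists>g\<in>rays. f t = fst z \<and> g t = snd z \<and> \<not> refinable t \<tau> f g"
    and "dist (fst z) (snd z) \<le> d0"
    using z(1) by (simp_all add: D_def case_prod_beta)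
  then obtain f1 g1 where f1g1: "z = (f1 t, g1 t)" "f1 \<in> rays" "g1 \<in> rays" "rdist t f1 g1 \<le> d0"
      "\<not> refinable t \<tau> f1 g1"
    by (metis prod.collapse)
  have "f1 t \<noteq> g1 t"
  proof
    assume "f1 t = g1 t"
    then have "eps_chain rays (rdist t) \<tau> [f1, g1]" "eps_chain rays (rdist t) K [f1, g1]"
      using f1g1 \<open>\<tau> > 0\<close> K by auto
    moreover from this have "eps_homotopic rays (rdist t) K [f1, g1] [f1, g1]"
      by (intro eps_homotopic_refl)
    ultimately have "refinable t \<tau> f1 g1"
      unfolding refinable_def by (intro exI[of _ "[f1, g1]"]) simp
    then show False using f1g1 by simp
  qed
  moreover have "\<forall>\<^sub>F (x, y) in at (f1 t, g1 t) within ?S \<times> ?S. rdist t f1 g1 \<le> dist x y"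
    unfolding eventually_at
  proof (intro exI[of _ \<sigma>] conjI ballI impI)
    fix w assume w: "w \<in> ?S \<times> ?S" "w \<noteq> (f1 t, g1 t) \<and> dist w (f1 t, g1 t) < \<sigma>"
    obtain x y where xy: "w = (x, y)" by (cases w)
    have d: "dist (f1 t) x < \<sigma>" "dist (g1 t) y < \<sigma>"
      using w dist_fst_le[of w "(f1 t, g1 t)"] dist_snd_le[of w "(f1 t, g1 t)"]
      by (auto simp: xy dist_commute)
    obtain f2 where f2: "f2 \<in> rays" "f2 t = x" using ray_above[OF \<open>t > 0\<close>, of x] w xy by auto
    obtain g2 where g2: "g2 \<in> rays" "g2 t = y" using ray_above[OF \<open>t > 0\<close>, of y] w xy by auto
    have "rdist t f1 g1 \<le> dist x y"
    proof (rule ccontr)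
      assume less: "\<not> rdist t f1 g1 \<le> dist x y"
      then have "w \<notin> D" using z(2)[of w] f1g1 xy by auto
      then have "refinable t \<tau> f2 g2"
        using f2 g2 w xy less f1g1(4) by (auto simp: D_def)
      then show False
        using near[of f1 g1 f2 g2] f1g1 f2 g2 d less by auto
    qed
    then show "case w of (x, y) \<Rightarrow> rdist t f1 g1 \<le> dist x y" by (simp add: xy)
  qed (use \<sigma> in auto)
  ultimately have "sink ?S (f1 t) (g1 t)"
    using f1g1 \<open>t > 0\<close> by (simp add: sink_def)
  then have "refinable t \<tau> f1 g1"
    using f1g1 d0 t \<open>\<tau> > 0\<close> by (intro refinable_sink) auto
  then show False using f1g1 by simp
qed

text \<open>The set of good radii \<open>s\<close> cannot end: from a good \<open>s\<close> one reaches every \<open>t \<ge> s\<close> with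
  \<open>2 (t - s) < \<iota> t\<close>, which covers \<open>t\<close> slightly above \<open>s\<close> as \<open>\<iota>\<close> is bounded below to the right of \<open>s\<close>,
  and covers limits \<open>t\<close> of good radii from the left since \<open>\<iota> t > 0\<close>.\<close>

proposition refine_upwards:
  assumes t0: "T0 \<le> t0" "t0 \<le> t" and fg: "f \<in> rays" "g \<in> rays" "rdist t0 f g < \<iota> t0" and "\<tau> > 0"
  shows "\<exists>\<alpha>. eps_chain rays (rdist t) \<tau> \<alpha> \<and> hd \<alpha> = f \<and> last \<alpha> = g \<and>
    eps_homotopic rays (rdist t0) K \<alpha> [f, g]"
proof -
  define G where "G s \<longleftrightarrow> (\<forall>\<tau>>0. \<exists>\<alpha>. eps_chain rays (rdist s) \<tau> \<alpha> \<and> hd \<alpha> = f \<and> last \<alpha> = g \<and>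
    eps_homotopic rays (rdist t0) K \<alpha> [f, g])" for s
  have base: "G t0"
    using refinable_short[OF t0(1) fg] by (simp add: G_def refinable_def)
  have step: "G t" if G: "G s" and st: "t0 \<le> s" "s \<le> t" "2 * (t - s) < \<iota> t" for s t
    unfolding G_def
  proof (intro allI impI)
    fix \<tau> :: real assume "\<tau> > 0"
    \<comment> \<open>What is left of \<open>\<iota> t\<close> after the growth by at most
      \<open>2 * (t - s)\<close>: links below \<open>\<sigma>\<close> at radius \<open>s\<close> are
      below \<open>\<iota> t\<close> at radius \<open>t\<close>.\<close>
    define \<sigma> where "\<sigma> = \<iota> t - 2 * (t - s)"
    have "\<sigma> > 0" using st by (simp add: \<sigma>_def)
    then obtain \<alpha> where \<alpha>: "eps_chain rays (rdist s) \<sigma> \<alpha>" "hd \<alpha> = f" "last \<alpha> = g"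
        "eps_homotopic rays (rdist t0) K \<alpha> [f, g]"
      using G unfolding G_def by blast
    have "\<exists>\<beta>. eps_chain rays (rdist t) \<tau> \<beta> \<and> hd \<beta> = a \<and> last \<beta> = b \<and>
        eps_homotopic rays (rdist t0) K \<beta> [a, b]"
      if ab: "a \<in> rays" "b \<in> rays" "rdist s a b < \<sigma>" for a b
    proof -
      have "rdist t a b < \<iota> t"
        using dist_rays_expand[of a b s t] ab st t0 T0 by (simp add: \<sigma>_def)
      then obtain \<beta> where \<beta>: "eps_chain rays (rdist t) \<tau> \<beta>" "hd \<beta> = a" "last \<beta> = b"
          "eps_homotopic rays (rdist t) K \<beta> [a, b]"
        using refinable_short[of t a b \<tau>] ab st t0 \<open>\<tau> > 0\<close> unfolding refinable_def by auto
      have "eps_homotopic rays (rdist t0) K \<beta> [a, b]"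
        by (rule eps_homotopic_mono[OF \<beta>(4)])
          (use dist_rays_mono[of _ _ t0 t] st t0 T0 in fastforce)
      then show ?thesis using \<beta> by blast
    qed
    from eps_chain_refine[OF \<alpha>(1) this]
    obtain \<gamma> where \<gamma>: "eps_chain rays (rdist t) \<tau> \<gamma>" "hd \<gamma> = f" "last \<gamma> = g"
        "eps_homotopic rays (rdist t0) K \<gamma> \<alpha>"
      using \<alpha> by auto
    then show "\<exists>\<alpha>. eps_chain rays (rdist t) \<tau> \<alpha> \<and> hd \<alpha> = f \<and> last \<alpha> = g \<and>
        eps_homotopic rays (rdist t0) K \<alpha> [f, g]"
      using eps_homotopic_trans[OF \<gamma>(4) \<alpha>(4)] by blast
  qed
  have "G s" if "t0 \<le> s" for s
  proof (rule ccontr)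
    define B where "B = {s. t0 \<le> s \<and> \<not> G s}"
    assume "\<not> G s"
    then have "s \<in> B" using that by (simp add: B_def)
    then have "B \<noteq> {}" by auto
    have bdd: "bdd_below B" by (auto simp: B_def)
    define m where "m = Inf B"
    have "t0 \<le> m"
      unfolding m_def using \<open>B \<noteq> {}\<close> by (intro cInf_greatest) (auto simp: B_def)
    have below: "G u" if "t0 \<le> u" "u < m" for u
      using that cInf_lower[OF _ bdd, of u] by (auto simp: B_def m_def)
    have "\<iota> m > 0" using iota_pos \<open>t0 \<le> m\<close> t0 by simp
    have "G m"
    proof (cases "m = t0")
      case False
      \<comment> \<open>A good radius so close to \<open>m\<close> that \<open>2 * (m - u)\<close>
        is at most half of \<open>\<iota> m\<close>.\<close>
      define u where "u = max t0 (m - \<iota> m / 4)"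
      have "t0 \<le> u" "u < m" "2 * (m - u) < \<iota> m"
        using False \<open>t0 \<le> m\<close> \<open>\<iota> m > 0\<close> by (auto simp: u_def max_def field_simps)
      then show ?thesis using step[OF below, of u m] by auto
    qed (use base in simp)
    obtain c \<delta> where c: "c > 0" "\<delta> > 0" "\<And>s. m \<le> s \<Longrightarrow> s < m + \<delta> \<Longrightarrow> c \<le> \<iota> s"
      using iota_right[of m] \<open>t0 \<le> m\<close> t0 by auto
    \<comment> \<open>A bad radius this close to the infimum is within reach of \<open>m\<close>:
      twice its distance from \<open>m\<close> is below \<open>c\<close>, a lower bound of
      \<open>\<iota>\<close> there.\<close>
    have "Inf B < m + min \<delta> (c / 2)"
      using c by (simp add: m_def)
    then obtain b where b: "b \<in> B" "b < m + min \<delta> (c / 2)"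
      using cInf_lessD[OF \<open>B \<noteq> {}\<close>] by blast
    then have "m \<le> b"
      using cInf_lower[OF _ bdd] by (simp add: m_def)
    then have "2 * (b - m) < \<iota> b"
      using c(3)[of b] b(2) by (auto simp: min_def split: if_splits)
    then have "G b"
      using step[OF \<open>G m\<close>] \<open>t0 \<le> m\<close> \<open>m \<le> b\<close> by auto
    then show False using b by (simp add: B_def)
  qed
  then show ?thesis
    using t0 \<open>\<tau> > 0\<close> unfolding G_def by blast
qed

theorem weakly_chained_boundary:
  assumes conn: "connected_space (visual_boundary x0)"
  shows "weakly_chained (visual_boundary x0)"
proof -
  have "\<exists>\<delta>>0. \<forall>x\<in>rays. \<forall>y\<in>rays. ray_dist x y < \<delta> \<longrightarrow>
        (\<forall>\<tau>>0. \<exists>\<alpha>. eps_chain rays ray_dist \<tau> \<alpha> \<and> hd \<alpha> = x \<and> last \<alpha> = y \<and>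
                   eps_homotopic rays ray_dist \<epsilon> \<alpha> [x, y])" if "\<epsilon> > 0" for \<epsilon> :: real
  proof -
    \<comment> \<open>At radius \<open>s\<close> the cut-off is \<open>\<epsilon> / 2\<close>. The
      radius \<open>t0\<close> is so large that a distance below \<open>K\<close> there contracts to
      at most \<open>\<epsilon> / 2\<close> at \<open>s\<close>.\<close>
    define s where "s = 2 / \<epsilon>"
    define t0 where "t0 = max T0 (max s (s * K * 2 / \<epsilon>))"
    have s: "s > 0" "1 / s = \<epsilon> / 2" using that by (auto simp: s_def)
    have t0: "T0 \<le> t0" "s \<le> t0" "s * K * 2 / \<epsilon> \<le> t0" by (auto simp: t0_def)
    then have "t0 > 0" using T0 by simp
    have close: "ray_dist f g < \<epsilon>" if fg: "f \<in> rays" "g \<in> rays" "rdist t0 f g < K" for f g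
    proof -
      have "rdist s f g \<le> s / t0 * rdist t0 f g"
        using dist_rays_contract[OF fg(1,2) s(1) t0(2)] .
      also have "\<dots> \<le> s / t0 * K"
        using fg s \<open>t0 > 0\<close> by (intro mult_left_mono) auto
      also have "\<dots> \<le> \<epsilon> / 2"
        using t0(3) \<open>t0 > 0\<close> \<open>\<epsilon> > 0\<close> by (simp add: field_simps)
      finally have "ray_dist f g \<le> \<epsilon> / 2"
        using fg s by (intro ray_dist_le[of f g s]) auto
      then show ?thesis using \<open>\<epsilon> > 0\<close> by simp
    qed
    \<comment> \<open>The minimum in the assumption is the required \<open>\<delta>\<close>: by
      \<open>dist_less_ray_dist\<close> it forces a distance below \<open>\<iota> t0\<close> at
      radius \<open>t0\<close>.\<close>
    have "\<exists>\<alpha>. eps_chain rays ray_dist \<tau> \<alpha> \<and> hd \<alpha> = f \<and> last \<alpha> = g \<and>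
        eps_homotopic rays ray_dist \<epsilon> \<alpha> [f, g]"
      if fg: "f \<in> rays" "g \<in> rays" "ray_dist f g < min (\<iota> t0) (1 / max 1 t0)" and "\<tau> > 0" for f g \<tau>
    proof -
      have short: "rdist t0 f g < \<iota> t0"
        using dist_less_ray_dist[OF fg(1,2) \<open>t0 > 0\<close> fg(3)] .
      \<comment> \<open>Far enough out for the cut-off to be at most \<open>\<tau> / 2\<close>, so
        that a mesh of \<open>\<tau> / 2\<close> at this radius is one of \<open>\<tau>\<close> in
        the boundary metric.\<close>
      define t where "t = max t0 (2 / \<tau>)"
      have t: "t0 \<le> t" "t > 0" "1 / t \<le> \<tau> / 2"
        using \<open>t0 > 0\<close> \<open>\<tau> > 0\<close> by (auto simp: t_def max_def field_simps)
      obtain \<alpha> where \<alpha>: "eps_chain rays (rdist t) (\<tau> / 2) \<alpha>" "hd \<alpha> = f" "last \<alpha> = g"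
          "eps_homotopic rays (rdist t0) K \<alpha> [f, g]"
        using refine_upwards[OF t0(1) t(1) fg(1,2) short, of "\<tau> / 2"] \<open>\<tau> > 0\<close> by auto
      have "eps_chain rays ray_dist \<tau> \<alpha>"
      proof (rule eps_chain_mono[OF \<alpha>(1)])
        fix a b assume "a \<in> rays" "b \<in> rays" "rdist t a b < \<tau> / 2"
        then have "ray_dist a b \<le> \<tau> / 2"
          using t by (intro ray_dist_le[of a b t]) auto
        then show "ray_dist a b < \<tau>" using \<open>\<tau> > 0\<close> by simp
      qed
      moreover have "eps_homotopic rays ray_dist \<epsilon> \<alpha> [f, g]"
        using eps_homotopic_mono[OF \<alpha>(4)] close by blast
      ultimately show ?thesis using \<alpha> by blast
    qed
    moreover have "min (\<iota> t0) (1 / max 1 t0) > 0"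
      using iota_pos[OF t0(1)] by auto
    ultimately show ?thesis by blast
  qed
  moreover have "chain_connected rays ray_dist"
    using conn by (intro chain_connected_connected_space Metric_space_rays) (simp add: mtopology_rays)
  ultimately have "weakly_chained_metric rays ray_dist"
    unfolding weakly_chained_metric_def by blast
  then show ?thesis
    unfolding weakly_chained_def
    using compact_visual_boundary Metric_space_rays mtopology_rays by (auto simp: rays_def)
qed

end

section \<open>Homotopies of paths outside balls\<close>

lemma path_compose_linepath:
  fixes a b :: real
  assumes "continuous_on (closed_segment a b) F"
  shows "path (F \<circ> linepath a b)"
  unfolding path_def o_def
  by (intro continuous_on_compose2[OF assms] continuous_intros) (auto intro: linepath_in_path)

text \<open>Reparametrisations and the two ways round a square are paths in a convex parameter
  domain, where homotopies are linear; composing with \<open>F\<close> transports them.\<close>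

lemma homotopic_paths_convex_image:
  fixes W :: "'b::real_normed_vector set" and F :: "'b \<Rightarrow> 'a::topological_space"
  assumes "convex W" "continuous_on W F" "F ` W \<subseteq> S"
    and "path p" "path q" "path_image p \<subseteq> W" "path_image q \<subseteq> W"
    and "pathstart p = pathstart q" "pathfinish p = pathfinish q"
  shows "homotopic_paths S (F \<circ> p) (F \<circ> q)"
proof (rule homotopic_paths_continuous_image)
  show "homotopic_paths W p q"
  proof (rule homotopic_paths_linear)
    fix t :: real assume "t \<in> {0..1}"
    then have "p t \<in> W" "q t \<in> W" using assms(6,7) unfolding path_image_def by blast+
    then show "closed_segment (p t) (q t) \<subseteq> W"
      using assms(1) closed_segment_subset by blast
  qed (use assms in auto)
qed (use assms in auto)

text \<open>In the parameter interval of \<open>p +++ q\<close> the long path runs from 0 to 1 and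
  back to 1/2, which is homotopic to running from 0 to 1/2.\<close>

lemma homotopic_paths_cancel_right:
  assumes "path p" "path q" "pathfinish p = pathstart q" "path_image p \<subseteq> S" "path_image q \<subseteq> S"
  shows "homotopic_paths S ((p +++ q) +++ reversepath q) p"
proof -
  let ?Q = "p +++ q"
  have Q: "path ?Q" "path_image ?Q \<subseteq> S"
    using assms by (auto simp: path_image_join)
  then have im: "?Q ` {0..1} \<subseteq> S" and cont: "continuous_on {0..1} ?Q"
    by (auto simp: path_image_def path_def)
  have h: "homotopic_paths S (?Q \<circ> (linepath 0 1 +++ linepath 1 (1/2))) (?Q \<circ> linepath 0 (1/2))"
    by (intro homotopic_paths_convex_image[OF _ cont im])
      (auto simp: path_image_join closed_segment_eq_real_ivl)
  have "(?Q \<circ> (linepath 0 1 +++ linepath 1 (1/2))) t = (?Q +++ reversepath q) t"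
    if "t \<in> {0..1}" for t
  proof (cases "t \<le> 1/2")
    case True
    then show ?thesis by (simp add: joinpaths_def linepath_def)
  next
    case False
    then have "linepath 1 (1/2) (2 * t - 1) = (3/2 - t :: real)"
      by (simp add: linepath_def field_simps)
    \<comment> \<open>For \<open>t = 1\<close> the argument is 1/2, where \<open>p +++ q\<close>
      still takes its value from \<open>p\<close>; the values agree because the paths meet.\<close>
    moreover have "?Q (3/2 - t) = q (1 - (2 * t - 1))"
    proof (cases "t = 1")
      case True
      then show ?thesis using assms(3) by (simp add: joinpaths_def pathstart_def pathfinish_def)
    next
      case False
      then have "2 * (3/2 - t) - 1 = 1 - (2 * t - 1)" "\<not> 3/2 - t \<le> 1/2"
        using that by auto
      then show ?thesis by (simp only: joinpaths_def if_False)
    qed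
    ultimately show ?thesis
      using False by (simp add: joinpaths_def[of _ "linepath 1 (1/2)"] joinpaths_def[of ?Q] reversepath_def)
  qed
  then have "homotopic_paths S ((?Q +++ reversepath q)) (?Q \<circ> (linepath 0 1 +++ linepath 1 (1/2)))"
    using homotopic_paths_imp_path[OF h] homotopic_paths_imp_subset[OF h]
    by (intro homotopic_paths_sym[OF homotopic_paths_eq]) auto
  also note h
  also have "homotopic_paths S (?Q \<circ> linepath 0 (1/2)) p"
  proof (rule homotopic_paths_eq)
    show "(?Q \<circ> linepath 0 (1/2)) t = p t" if "t \<in> {0..1}" for t
      using that by (simp add: joinpaths_def linepath_def)
  qed (use homotopic_paths_imp_path[OF h] homotopic_paths_imp_subset[OF h] in auto)
  finally show ?thesis .
qed

text \<open>A square of paths (left, right, bottom, top) that commutes up to homotopy in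
  \<open>S\<close>. No filling map is recorded, so pasting squares is calculation in the fundamental
  groupoid.\<close>

definition path_square ::
  "'a::topological_space set \<Rightarrow> (real \<Rightarrow> 'a) \<Rightarrow> (real \<Rightarrow> 'a) \<Rightarrow> (real \<Rightarrow> 'a) \<Rightarrow> (real \<Rightarrow> 'a) \<Rightarrow> bool" where
  "path_square S l r b t \<longleftrightarrow>
     path l \<and> path r \<and> path b \<and> path t \<and>
     path_image l \<subseteq> S \<and> path_image r \<subseteq> S \<and> path_image b \<subseteq> S \<and> path_image t \<subseteq> S \<and>
     pathstart l = pathstart b \<and> pathfinish b = pathstart r \<and>
     pathfinish l = pathstart t \<and> pathfinish r = pathfinish t \<and>
     homotopic_paths S (b +++ r) (l +++ t)"

lemma path_square_subset: "path_square S l r b t \<Longrightarrow> S \<subseteq> S' \<Longrightarrow> path_square S' l r b t"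
  unfolding path_square_def by (blast intro: homotopic_paths_subset)

lemma path_square_homotopic:
  assumes sq: "path_square S l r b t"
    and h: "homotopic_paths S l l'" "homotopic_paths S r r'" "homotopic_paths S b b'" "homotopic_paths S t t'"
  shows "path_square S l' r' b' t'"
proof -
  have ends: "pathstart l' = pathstart l" "pathfinish l' = pathfinish l"
    "pathstart r' = pathstart r" "pathfinish r' = pathfinish r"
    "pathstart b' = pathstart b" "pathfinish b' = pathfinish b"
    "pathstart t' = pathstart t" "pathfinish t' = pathfinish t"
    using h homotopic_paths_imp_pathstart homotopic_paths_imp_pathfinish by metis+
  have "homotopic_paths S (b' +++ r') (b +++ r)"
    by (rule homotopic_paths_join) (use h sq ends in \<open>auto simp: path_square_def homotopic_paths_sym_eq\<close>)
  moreover have "homotopic_paths S (l +++ t) (l' +++ t')"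
    by (rule homotopic_paths_join) (use h sq in \<open>auto simp: path_square_def\<close>)
  ultimately have "homotopic_paths S (b' +++ r') (l' +++ t')"
    using sq unfolding path_square_def by (meson homotopic_paths_trans)
  then show ?thesis
    using sq h homotopic_paths_imp_path homotopic_paths_imp_subset unfolding path_square_def ends
    by metis
qed

lemma path_square_join_horizontal:
  assumes 1: "path_square S l m b1 t1" and 2: "path_square S m r b2 t2"
  shows "path_square S l r (b1 +++ b2) (t1 +++ t2)"
proof -
  note sq = 1[unfolded path_square_def] 2[unfolded path_square_def]
  have "homotopic_paths S ((b1 +++ b2) +++ r) (b1 +++ (b2 +++ r))"
    using sq by (intro homotopic_paths_sym[OF homotopic_paths_assoc]) auto
  also have "homotopic_paths S (b1 +++ (b2 +++ r)) (b1 +++ (m +++ t2))"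
    by (rule homotopic_paths_join) (use sq in auto)
  also have "homotopic_paths S (b1 +++ (m +++ t2)) ((b1 +++ m) +++ t2)"
    using sq by (intro homotopic_paths_assoc) auto
  also have "homotopic_paths S ((b1 +++ m) +++ t2) ((l +++ t1) +++ t2)"
    by (rule homotopic_paths_join) (use sq in auto)
  also have "homotopic_paths S ((l +++ t1) +++ t2) (l +++ (t1 +++ t2))"
    using sq by (intro homotopic_paths_sym[OF homotopic_paths_assoc]) auto
  finally show ?thesis
    using sq by (auto simp: path_square_def path_image_join)
qed

lemma path_square_join_vertical:
  assumes 1: "path_square S l1 r1 b m" and 2: "path_square S l2 r2 m t"
  shows "path_square S (l1 +++ l2) (r1 +++ r2) b t"
proof -
  note sq = 1[unfolded path_square_def] 2[unfolded path_square_def]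
  have "homotopic_paths S (b +++ (r1 +++ r2)) ((b +++ r1) +++ r2)"
    using sq by (intro homotopic_paths_assoc) auto
  also have "homotopic_paths S ((b +++ r1) +++ r2) ((l1 +++ m) +++ r2)"
    by (rule homotopic_paths_join) (use sq in auto)
  also have "homotopic_paths S ((l1 +++ m) +++ r2) (l1 +++ (m +++ r2))"
    using sq by (intro homotopic_paths_sym[OF homotopic_paths_assoc]) auto
  also have "homotopic_paths S (l1 +++ (m +++ r2)) (l1 +++ (l2 +++ t))"
    by (rule homotopic_paths_join) (use sq in auto)
  also have "homotopic_paths S (l1 +++ (l2 +++ t)) ((l1 +++ l2) +++ t)"
    using sq by (intro homotopic_paths_assoc) auto
  finally show ?thesis
    using sq by (auto simp: path_square_def path_image_join)
qed

text \<open>The two ways round the unit square are homotopic in it by convexity.\<close>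

lemma path_square_map:
  fixes F :: "real \<times> real \<Rightarrow> 'a::topological_space"
  assumes F: "continuous_on ({0..1} \<times> {0..1}) F" and S: "F ` ({0..1} \<times> {0..1}) \<subseteq> S"
  shows "path_square S (\<lambda>v. F (0, v)) (\<lambda>v. F (1, v)) (\<lambda>s. F (s, 0)) (\<lambda>s. F (s, 1))"
proof -
  let ?W = "{0..1::real} \<times> {0..1::real}"
  have seg: "path_image (linepath x y) \<subseteq> ?W" if "x \<in> ?W" "y \<in> ?W" for x y
    using that by (simp add: closed_segment_subset convex_Times)
  have "homotopic_paths S (F \<circ> (linepath (0,0) (1,0) +++ linepath (1,0) (1,1)))
      (F \<circ> (linepath (0,0) (0,1) +++ linepath (0,1) (1,1)))"
    by (intro homotopic_paths_convex_image[OF _ F S] convex_Times path_join_imp path_linepath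
        order.trans[OF path_image_join_subset] Un_least seg) auto
  moreover have "F \<circ> linepath (0,0) (1,0) = (\<lambda>s. F (s, 0))" "F \<circ> linepath (1,0) (1,1) = (\<lambda>v. F (1, v))"
    "F \<circ> linepath (0,0) (0,1) = (\<lambda>v. F (0, v))" "F \<circ> linepath (0,1) (1,1) = (\<lambda>s. F (s, 1))"
    by (auto simp: linepath_def fun_eq_iff)
  ultimately have "homotopic_paths S ((\<lambda>s. F (s, 0)) +++ (\<lambda>v. F (1, v))) ((\<lambda>v. F (0, v)) +++ (\<lambda>s. F (s, 1)))"
    by (simp add: path_compose_join)
  moreover have "path (\<lambda>s. F (s, c))" "path (\<lambda>s. F (c, s))" if "c \<in> {0..1}" for c
    unfolding path_def using that
    by (auto intro!: continuous_on_compose2[OF F] continuous_intros)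
  ultimately show ?thesis
    using S by (auto simp: path_square_def pathstart_def pathfinish_def path_image_def image_subset_iff)
qed

text \<open>A single point gives a constant path, so the interpolation of a longer chain ends with a
  constant piece; for a two-point chain this piece is removed up to homotopy.\<close>

fun geod_path :: "'a::metric_space list \<Rightarrow> real \<Rightarrow> 'a" where
  "geod_path [] = (\<lambda>_. undefined)"
| "geod_path [x] = geod x x"
| "geod_path (x # y # zs) = geod x y +++ geod_path (y # zs)"

section \<open>Geodesic homotopies outside balls about the base point\<close>

context cat0
begin

definition beyond :: "real \<Rightarrow> 'a set" where
  "beyond R = {p. R \<le> dist x0 p}"

lemma beyond_mono: "R \<le> R' \<Longrightarrow> beyond R' \<subseteq> beyond R"
  by (auto simp: beyond_def)

lemma cball_subset_beyond: "x \<in> beyond T \<Longrightarrow> cball x C \<subseteq> beyond (T - C)"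
proof
  fix p assume "x \<in> beyond T" "p \<in> cball x C"
  then show "p \<in> beyond (T - C)"
    using dist_triangle[of x0 x p] by (simp add: beyond_def dist_commute)
qed

lemma homotopic_paths_geod:
  fixes g h :: "real \<Rightarrow> 'a"
  assumes "path g" "path h" "pathstart g = pathstart h" "pathfinish g = pathfinish h"
    and S: "\<And>s u. s \<in> {0..1} \<Longrightarrow> u \<in> {0..1} \<Longrightarrow> geod (g s) (h s) u \<in> S"
  shows "homotopic_paths S g h"
  unfolding homotopic_paths
proof (intro exI[of _ "\<lambda>(u, s). geod (g s) (h s) u"] conjI)
  let ?W = "{0..1::real} \<times> {0..1::real}"
  have "continuous_on ?W (\<lambda>z. p (snd z))" if "path p" for p :: "real \<Rightarrow> 'a"
    by (rule continuous_on_compose2[OF that[unfolded path_def] continuous_on_snd[OF continuous_on_id]]) auto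
  from continuous_on_geod[OF this[OF assms(1)] this[OF assms(2)] continuous_on_fst[OF continuous_on_id]]
  have "continuous_on ?W (\<lambda>z. geod (g (snd z)) (h (snd z)) (fst z))"
    by auto
  then show "continuous_on ({0..1} \<times> {0..1}) (\<lambda>(u, s). geod (g s) (h s) u)"
    by (simp add: case_prod_beta)
qed (use assms in \<open>auto simp: pathstart_def pathfinish_def\<close>)

text \<open>Balls are convex in a CAT(0) space, whereas the outside of a ball is not in general. The
  homotopy is therefore made inside \<open>cball x C\<close>, at the price of reducing the radius by
  \<open>C\<close>.\<close>

lemma homotopic_paths_cball:
  assumes "path g" "path h" "pathstart g = pathstart h" "pathfinish g = pathfinish h"
    and "path_image g \<subseteq> cball x C" "path_image h \<subseteq> cball x C" "x \<in> beyond T"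
  shows "homotopic_paths (beyond (T - C)) g h"
proof (rule homotopic_paths_geod[OF assms(1-4)])
  fix s u :: real assume su: "s \<in> {0..1}" "u \<in> {0..1}"
  then have "g s \<in> cball x C" "h s \<in> cball x C"
    using assms(5,6) unfolding path_image_def by blast+
  then have "geod (g s) (h s) u \<in> cball x C"
    using geod_in_cball su by (simp only: mem_cball)
  then show "geod (g s) (h s) u \<in> beyond (T - C)"
    using cball_subset_beyond[OF assms(7)] by blast
qed

lemma path_image_geod_cball:
  fixes p x y :: 'a
  assumes "x \<in> cball p C" "y \<in> cball p C"
  shows "path_image (geod x y) \<subseteq> cball p C"
  using geod_in_cball[of _ p x C y] assms unfolding path_image_def by fastforce

lemma homotopic_geod_triangle:
  assumes "x \<in> beyond T" "dist x y \<le> C" "dist x z \<le> C"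
  shows "homotopic_paths (beyond (T - C)) (geod x y) (geod x z +++ geod z y)"
proof (rule homotopic_paths_cball[OF _ _ _ _ _ _ assms(1)])
  have "0 \<le> C" using assms(2) zero_le_dist order_trans by blast
  then show "path_image (geod x y) \<subseteq> cball x C"
    using assms by (intro path_image_geod_cball) auto
  show "path_image (geod x z +++ geod z y) \<subseteq> cball x C"
    using assms \<open>0 \<le> C\<close>
    by (intro order.trans[OF path_image_join_subset] Un_least path_image_geod_cball) auto
qed (auto simp: path_geod)

lemma path_image_geod_beyond:
  assumes "x \<in> beyond T" "dist x y \<le> C"
  shows "path_image (geod x y) \<subseteq> beyond (T - C)"
  using homotopic_paths_imp_subset[OF homotopic_geod_triangle[OF assms assms(2)]] by blast

lemma geod_path_ends:
  assumes "xs \<noteq> []"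
  shows "pathstart (geod_path xs) = hd (xs :: 'a list)" "pathfinish (geod_path xs) = last xs"
  using assms by (induction xs rule: geod_path.induct) auto

lemma path_geod_path: "xs \<noteq> [] \<Longrightarrow> path (geod_path (xs :: 'a list))"
  by (induction xs rule: geod_path.induct) (auto simp: path_geod geod_path_ends)

lemma path_image_geod_path:
  assumes "eps_chain (beyond T) dist C xs" "0 \<le> C"
  shows "path_image (geod_path xs) \<subseteq> beyond (T - C)"
  using assms(1)
proof (induction xs rule: geod_path.induct)
  case (2 x)
  then show ?case using \<open>0 \<le> C\<close> path_image_geod_beyond[of x T x C] by simp
next
  case (3 x y zs)
  then have "path_image (geod x y) \<subseteq> beyond (T - C)"
    by (intro path_image_geod_beyond) auto
  then show ?case using 3 by (simp add: path_image_join geod_path_ends)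
qed simp

text \<open>Inserting a point replaces one side of a small geodesic triangle by the other
  two.\<close>

lemma homotopic_geod_path_insert:
  assumes "us \<noteq> []" "vs \<noteq> []" "eps_chain (beyond T) dist C (us @ vs)" "eps_chain (beyond T) dist C (us @ z # vs)"
    and "0 \<le> C"
  shows "homotopic_paths (beyond (T - C)) (geod_path (us @ vs)) (geod_path (us @ z # vs))"
  using assms(1,3,4)
proof (induction us rule: list_nonempty_induct)
  case (single x)
  obtain y ws where vs: "vs = y # ws" using \<open>vs \<noteq> []\<close> by (cases vs) auto
  let ?S = "beyond (T - C)"
  have x: "x \<in> beyond T" "dist x y \<le> C" "dist x z \<le> C" "dist z y \<le> C" "z \<in> beyond T"
    and ch: "eps_chain (beyond T) dist C (y # ws)"
    using single vs by auto
  have im: "path_image (geod x z) \<subseteq> ?S" "path_image (geod z y) \<subseteq> ?S"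
    using x by (simp_all add: path_image_geod_beyond)
  have rest: "homotopic_paths ?S (geod_path (y # ws)) (geod_path (y # ws))"
    using path_image_geod_path[OF ch \<open>0 \<le> C\<close>] by (simp add: path_geod_path)
  have "homotopic_paths ?S (geod x y +++ geod_path (y # ws)) ((geod x z +++ geod z y) +++ geod_path (y # ws))"
    by (rule homotopic_paths_join[OF homotopic_geod_triangle rest]) (use x in \<open>auto simp: geod_path_ends\<close>)
  also have "homotopic_paths ?S \<dots> (geod x z +++ (geod z y +++ geod_path (y # ws)))"
    using im rest by (intro homotopic_paths_sym[OF homotopic_paths_assoc]) (auto simp: path_geod geod_path_ends)
  finally show ?case using vs by simp
next
  case (cons x us)
  then obtain y ws where us: "us = y # ws" by (cases us) auto
  have "homotopic_paths (beyond (T - C)) (geod x y) (geod x y)"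
    using path_image_geod_beyond[of x T y C] cons.prems us by (simp add: path_geod)
  then show ?case
    using cons us by (auto intro!: homotopic_paths_join simp: geod_path_ends)
qed

text \<open>The passage from discrete to continuous homotopies. All steps take place in the same
  set, so the loss of \<open>C\<close> does not grow with their number.\<close>

lemma homotopic_geod_path:
  assumes h: "eps_homotopic (beyond T) dist C xs ys" and "0 \<le> C"
  shows "homotopic_paths (beyond (T - C)) (geod_path xs) (geod_path ys)"
  using h
proof (induction rule: eps_homotopic_induct)
  case refl
  then show ?case
    using path_image_geod_path[OF refl \<open>0 \<le> C\<close>] path_geod_path[OF eps_chain_nonempty[OF refl]] by simp
next
  case (step ys zs)
  have "homotopic_paths (beyond (T - C)) (geod_path ys) (geod_path zs)"
    using step(2) homotopic_geod_path_insert[OF _ _ _ _ \<open>0 \<le> C\<close>] homotopic_paths_sym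
    unfolding eps_step_def inserts_point_def by metis
  then show ?case using step homotopic_paths_trans by blast
qed

end

lemma eps_homotopic_map:
  assumes "eps_homotopic M d \<epsilon> xs ys" "\<phi> ` M \<subseteq> M'" "\<And>x y. x \<in> M \<Longrightarrow> y \<in> M \<Longrightarrow> d' (\<phi> x) (\<phi> y) = d x y"
  shows "eps_homotopic M' d' \<epsilon> (map \<phi> xs) (map \<phi> ys)"
proof -
  have ch: "eps_chain M' d' \<epsilon> (map \<phi> us)" if "eps_chain M d \<epsilon> us" for us
    using that assms(2,3) by (rule eps_chain_map)
  show ?thesis
    using assms(1)
  proof (induction rule: eps_homotopic_induct)
    case refl
    then show ?case
      using ch by (auto intro: eps_homotopic_refl)
  next
    case (step ys zs)
    have "inserts_point (map \<phi> us) (map \<phi> ws)" if "inserts_point us ws" for us ws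
    proof -
      obtain as z bs where "as \<noteq> []" "bs \<noteq> []" "us = as @ bs" "ws = as @ z # bs"
        using \<open>inserts_point us ws\<close> unfolding inserts_point_def by blast
      then show ?thesis
        unfolding inserts_point_def
        by (intro exI[of _ "map \<phi> as"] exI[of _ "\<phi> z"] exI[of _ "map \<phi> bs"]) simp
    qed
    then have "eps_step M' d' \<epsilon> (map \<phi> ys) (map \<phi> zs)"
      using step(2) ch unfolding eps_step_def by metis
    then show ?case
      using step eps_homotopic_trans eps_homotopic_step by blast
  qed
qed

section \<open>Squares spanned by neighbouring rays\<close>

context complete_cat0
begin

text \<open>\<open>a\<close> may exceed \<open>b\<close>; the ray is then run inwards.\<close>

definition ray_seg :: "(real \<Rightarrow> 'a) \<Rightarrow> real \<Rightarrow> real \<Rightarrow> real \<Rightarrow> 'a" where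
  "ray_seg f a b = f \<circ> linepath a b"

lemma ray_seg_ends [simp]: "pathstart (ray_seg f a b) = f a" "pathfinish (ray_seg f a b) = f b"
  by (simp_all add: ray_seg_def pathstart_compose pathfinish_compose)

lemma path_image_ray_seg:
  assumes "f \<in> rays" "0 < R" "R \<le> a" "R \<le> b"
  shows "path_image (ray_seg f a b) \<subseteq> beyond R"
  using assms
  by (auto simp: ray_seg_def path_image_compose closed_segment_eq_real_ivl beyond_def split: if_splits)

text \<open>The half-line of radii from \<open>R\<close> on is convex, so \<open>a\<close>,
  \<open>b\<close>, \<open>c\<close> may come in any order and backtracking cancels.\<close>

lemma homotopic_ray_seg_join:
  assumes "f \<in> rays" "0 < R" "R \<le> a" "R \<le> b" "R \<le> c"
  shows "homotopic_paths (beyond R) (ray_seg f a b +++ ray_seg f b c) (ray_seg f a c)"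
proof -
  have "homotopic_paths (beyond R) (f \<circ> (linepath a b +++ linepath b c)) (f \<circ> linepath a c)"
  proof (rule homotopic_paths_convex_image[of "{R..}"])
    show "continuous_on {R..} f"
      using assms by (intro continuous_on_subset[OF continuous_on_ray[OF assms(1)]]) auto
    show "f ` {R..} \<subseteq> beyond R"
      using assms by (auto simp: beyond_def)
  qed (use assms in \<open>auto simp: path_image_join closed_segment_eq_real_ivl split: if_splits\<close>)
  then show ?thesis
    by (simp add: ray_seg_def path_compose_join)
qed

text \<open>The distance of the rays increases with the radius, so the bound at \<open>T'\<close>
  keeps all geodesics between them at radii from \<open>T\<close> to \<open>T'\<close>
  short.\<close>

lemma path_square_ray_pair:
  assumes fg: "f \<in> rays" "g \<in> rays" "rdist T' f g < 1" and T: "0 < T" "T \<le> T'"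
  shows "path_square (beyond (T - 1)) (ray_seg f T T') (ray_seg g T T') (geod (f T) (g T)) (geod (f T') (g T'))"
proof -
  let ?l = "linepath T T'"
  let ?F = "\<lambda>z. geod (f (?l (snd z))) (g (?l (snd z))) (fst z)"
  have l: "T \<le> ?l v" "?l v \<le> T'" if "v \<in> {0..1}" for v
    using linepath_in_path[OF that, of T T'] T by (auto simp: closed_segment_eq_real_ivl)
  have l0: "?l v \<in> {0<..}" if "v \<in> {0..1}" for v
    using l[OF that] T by auto
  have c: "continuous_on ({0..1} \<times> {0..1}) (\<lambda>z::real \<times> real. h (?l (snd z)))" if "h \<in> rays" for h
  proof (rule continuous_on_compose2[OF continuous_on_ray[OF that]])
    show "continuous_on ({0..1} \<times> {0..1}) (\<lambda>z::real \<times> real. ?l (snd z))"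
      unfolding linepath_def by (intro continuous_intros)
  qed (use l0 in auto)
  have "continuous_on ({0..1} \<times> {0..1}) ?F"
    using fg by (intro continuous_on_geod c continuous_intros) auto
  moreover have "?F ` ({0..1} \<times> {0..1}) \<subseteq> beyond (T - 1)"
  proof
    fix p assume "p \<in> ?F ` ({0..1} \<times> {0..1})"
    then obtain s v where sv: "s \<in> {0..1}" "v \<in> {0..1}" "p = geod (f (?l v)) (g (?l v)) s" by auto
    have "dist (f (?l v)) (g (?l v)) \<le> 1"
      using dist_rays_mono[of f g "?l v" T'] fg l[OF sv(2)] l0[OF sv(2)] by auto
    moreover have "f (?l v) \<in> beyond T"
      using fg l[OF sv(2)] l0[OF sv(2)] by (auto simp: beyond_def)
    ultimately have "path_image (geod (f (?l v)) (g (?l v))) \<subseteq> beyond (T - 1)"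
      by (intro path_image_geod_beyond)
    then show "p \<in> beyond (T - 1)" using sv by (auto simp: path_image_def)
  qed
  ultimately have "path_square (beyond (T - 1)) (\<lambda>v. ?F (0, v)) (\<lambda>v. ?F (1, v)) (\<lambda>s. ?F (s, 0)) (\<lambda>s. ?F (s, 1))"
    by (rule path_square_map)
  moreover have "?l 0 = T" "?l 1 = T'" by (simp_all add: linepath_def)
  ultimately show ?thesis
    by (simp add: ray_seg_def o_def)
qed

lemma path_square_ray_chain:
  assumes "eps_chain rays (rdist T') 1 \<alpha>" and T: "0 < T" "T \<le> T'"
  shows "path_square (beyond (T - 1)) (ray_seg (hd \<alpha>) T T') (ray_seg (last \<alpha>) T T')
    (geod_path (map (\<lambda>f. f T) \<alpha>)) (geod_path (map (\<lambda>f. f T') \<alpha>))"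
  using assms(1)
proof (induction \<alpha> rule: induct_list012)
  case (2 f)
  then show ?case using path_square_ray_pair[of f f] T by simp
next
  case (3 f g \<alpha>)
  then have "g \<in> rays" using eps_chain_set by fastforce
  then have "path_square (beyond (T - 1)) (ray_seg f T T') (ray_seg g T T') (geod (f T) (g T)) (geod (f T') (g T'))"
    using 3 T by (intro path_square_ray_pair) auto
  from path_square_join_horizontal[OF this] 3 show ?case by simp
qed simp

end

section \<open>Pushing paths outwards\<close>

context refining
begin

text \<open>The refined chain has mesh 1 at radius \<open>T'\<close>, so its interpolation there
  loses only 1, while at radius \<open>T\<close> it is \<open>K\<close>-homotopic to the two-point
  chain, which costs \<open>K\<close> at the bottom of the ladder.\<close>

lemma path_square_short:
  assumes T: "T0 \<le> T" "T \<le> T'" and fg: "f \<in> rays" "g \<in> rays" "rdist T f g < \<iota> T"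
  obtains c where "path_square (beyond (T - K)) (ray_seg f T T') (ray_seg g T T') (geod (f T) (g T)) c"
    "path_image c \<subseteq> beyond (T' - 1)"
proof -
  have "0 < T" using T T0 by simp
  have TK: "beyond (T - 1) \<subseteq> beyond (T - K)"
    using K by (intro beyond_mono) auto
  obtain \<alpha> where \<alpha>: "eps_chain rays (rdist T') 1 \<alpha>" "hd \<alpha> = f" "last \<alpha> = g"
      "eps_homotopic rays (rdist T) K \<alpha> [f, g]"
    using refine_upwards[OF T fg, of 1] by auto
  have at: "(\<lambda>f. f R) ` rays \<subseteq> beyond R" if "R > 0" for R
    using that by (auto simp: beyond_def)
  have sq: "path_square (beyond (T - K)) (ray_seg f T T') (ray_seg g T T')
      (geod_path (map (\<lambda>f. f T) \<alpha>)) (geod_path (map (\<lambda>f. f T') \<alpha>))"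
    using path_square_subset[OF path_square_ray_chain[OF \<alpha>(1) \<open>0 < T\<close> T(2)] TK] \<alpha> by simp
  have fT: "f T \<in> beyond T" "dist (f T) (g T) \<le> K"
    using at[OF \<open>0 < T\<close>] fg iota_le[of T] by auto
  have "homotopic_paths (beyond (T - K)) (geod_path (map (\<lambda>f. f T) \<alpha>)) (geod_path (map (\<lambda>f. f T) [f, g]))"
    using K by (intro homotopic_geod_path eps_homotopic_map[OF \<alpha>(4)] at \<open>0 < T\<close>) auto
  also have "homotopic_paths (beyond (T - K)) (geod_path (map (\<lambda>f. f T) [f, g])) (geod (f T) (g T))"
    using homotopic_paths_sym[OF homotopic_geod_triangle[OF fT fT(2)]] by simp
  finally have "path_square (beyond (T - K)) (ray_seg f T T') (ray_seg g T T')
      (geod (f T) (g T)) (geod_path (map (\<lambda>f. f T') \<alpha>))"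
    using sq by (intro path_square_homotopic[OF sq]) (auto simp: path_square_def)
  moreover have "path_image (geod_path (map (\<lambda>f. f T') \<alpha>)) \<subseteq> beyond (T' - 1)"
    using \<open>0 < T\<close> T by (intro path_image_geod_path eps_chain_map[OF \<alpha>(1)] at) auto
  ultimately show ?thesis using that by blast
qed

text \<open>Both \<open>m\<close> and the geodesic between its ends lie in the ball of radius
  \<open>K\<close> about \<open>m 0\<close>, hence they are homotopic.\<close>

lemma path_square_short_path:
  assumes T: "T0 \<le> T" "T \<le> T'" and m: "path m" "path_image m \<subseteq> sphere x0 T"
    and small: "\<And>s. s \<in> {0..1} \<Longrightarrow> dist (m 0) (m s) < \<iota> T"
    and fg: "f \<in> rays" "g \<in> rays" "f T = m 0" "g T = m 1"
  obtains c where "path_square (beyond (T - K)) (ray_seg f T T') (ray_seg g T T') m c"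
    "path_image c \<subseteq> beyond (T' - 1)"
proof -
  obtain c where c: "path_square (beyond (T - K)) (ray_seg f T T') (ray_seg g T T') (geod (f T) (g T)) c"
      "path_image c \<subseteq> beyond (T' - 1)"
    using path_square_short[OF T fg(1,2)] small[of 1] fg by auto
  have "m 0 \<in> sphere x0 T" using m(2) unfolding path_image_def by force
  then have "m 0 \<in> beyond T" by (simp add: beyond_def)
  have "homotopic_paths (beyond (T - K)) (geod (f T) (g T)) m"
  proof (rule homotopic_paths_cball[OF _ _ _ _ _ _ \<open>m 0 \<in> beyond T\<close>])
    show "path_image (geod (f T) (g T)) \<subseteq> cball (m 0) K"
      using small[of 1] fg iota_le[of T] K by (intro path_image_geod_cball) auto
    show "path_image m \<subseteq> cball (m 0) K"
      using less_imp_le[OF less_le_trans[OF small iota_le]] by (simp add: path_image_def image_subset_iff)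
  qed (use fg m in \<open>auto simp: path_geod pathstart_def pathfinish_def\<close>)
  then have "path_square (beyond (T - K)) (ray_seg f T T') (ray_seg g T T') m c"
    using c by (intro path_square_homotopic[OF c(1)]) (auto simp: path_square_def)
  then show ?thesis using that c by blast
qed

text \<open>Uniform continuity cuts \<open>m\<close> into pieces shorter than
  \<open>\<iota> T\<close>. Choosing one ray through each division point gives adjacent squares a
  common side.\<close>

lemma path_square_sphere:
  assumes T: "T0 \<le> T" "T \<le> T'" and m: "path m" "path_image m \<subseteq> sphere x0 T"
    and fg: "f \<in> rays" "g \<in> rays" "f T = m 0" "g T = m 1"
  obtains c where "path_square (beyond (T - K)) (ray_seg f T T') (ray_seg g T T') m c"
    "path_image c \<subseteq> beyond (T' - 1)"
proof -
  have "T > 0" using T T0 by simp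
  have "uniformly_continuous_on {0..1} m"
    using m(1) unfolding path_def by (intro compact_uniformly_continuous) auto
  then obtain d where d: "d > 0" "\<And>x y. x \<in> {0..1} \<Longrightarrow> y \<in> {0..1} \<Longrightarrow> dist y x < d \<Longrightarrow> dist (m y) (m x) < \<iota> T"
    using iota_pos[OF T(1)] unfolding uniformly_continuous_on_def by metis
  obtain N :: nat where N: "N > 0" "1 / real N < d"
    using d(1) real_arch_inverse[of d] by (auto simp: inverse_eq_divide)
  have sub: "path (m \<circ> linepath a b)" "path_image (m \<circ> linepath a b) \<subseteq> sphere x0 T"
    if "a \<in> {0..1}" "b \<in> {0..1}" for a b
  proof -
    have ab: "closed_segment a b \<subseteq> {0..1}"
      using that by (simp add: closed_segment_subset)
    show "path (m \<circ> linepath a b)"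
      by (rule path_compose_linepath) (use m(1) ab in \<open>auto simp: path_def intro: continuous_on_subset\<close>)
    show "path_image (m \<circ> linepath a b) \<subseteq> sphere x0 T"
      using m(2) ab unfolding path_image_compose path_image_linepath unfolding path_image_def by blast
  qed
  have piece: "\<exists>c. path_square (beyond (T - K)) (ray_seg f T T') (ray_seg g T T') (m \<circ> linepath a b) c \<and>
      path_image c \<subseteq> beyond (T' - 1)"
    if "f \<in> rays" "g \<in> rays" "f T = m a" "g T = m b" "a \<in> {0..1}" "b \<in> {0..1}" "\<bar>b - a\<bar> \<le> 1 / N" for f g a b
  proof -
    have "dist ((m \<circ> linepath a b) 0) ((m \<circ> linepath a b) s) < \<iota> T" if s: "s \<in> {0..1}" for s
    proof -
      have "linepath a b s \<in> {0..1}"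
        using linepath_in_path[OF s, of a b] closed_segment_subset[of a "{0..1}" b] \<open>a \<in> {0..1}\<close> \<open>b \<in> {0..1}\<close> by auto
      have "a - linepath a b s = s * (a - b)"
        by (simp add: linepath_def algebra_simps)
      then have "dist a (linepath a b s) \<le> 1 * \<bar>b - a\<bar>"
        using s unfolding dist_real_def by (simp add: abs_mult mult_left_le_one_le abs_minus_commute)
      also have "1 * \<bar>b - a\<bar> \<le> 1 / N"
        using \<open>\<bar>b - a\<bar> \<le> 1 / N\<close> by simp
      also note N(2)
      finally have "dist a (linepath a b s) < d" .
      with \<open>linepath a b s \<in> {0..1}\<close> show ?thesis
        using d(2)[of "linepath a b s" a] \<open>a \<in> {0..1}\<close> by (simp add: linepath_0')
    qed
    note small = this and fgab = that
    have ends: "f T = (m \<circ> linepath a b) 0" "g T = (m \<circ> linepath a b) 1"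
      using that by (simp_all add: linepath_0' linepath_1')
    obtain c where "path_square (beyond (T - K)) (ray_seg f T T') (ray_seg g T T') (m \<circ> linepath a b) c"
        "path_image c \<subseteq> beyond (T' - 1)"
      by (rule path_square_short_path[OF T sub[OF fgab(5,6)] small fgab(1,2) ends])
    then show ?thesis by blast
  qed
  have upto: "\<exists>c. path_square (beyond (T - K)) (ray_seg f T T') (ray_seg g T T') (m \<circ> linepath 0 (n / N)) c \<and>
      path_image c \<subseteq> beyond (T' - 1)" if "n \<le> N" "g \<in> rays" "g T = m (n / N)" for n g
    using that
  proof (induction n arbitrary: g)
    case 0
    show ?case by (rule piece) (use 0 fg in auto)
  next
    case (Suc n)
    let ?a = "real n / N" and ?b = "real (Suc n) / N"
    have ab: "?a \<in> {0..1}" "?b \<in> {0..1}" "\<bar>?b - ?a\<bar> \<le> 1 / N"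
      using Suc.prems(1) N(1) by (auto simp: divide_simps)
    have "m ?a \<in> sphere x0 T" using m(2) ab(1) unfolding path_image_def by blast
    then obtain h where h: "h \<in> rays" "h T = m ?a" using ray_above[OF \<open>T > 0\<close>] by metis
    obtain c1 where c1: "path_square (beyond (T - K)) (ray_seg f T T') (ray_seg h T T') (m \<circ> linepath 0 ?a) c1"
        "path_image c1 \<subseteq> beyond (T' - 1)"
      using Suc.IH[OF Suc_leD[OF Suc.prems(1)] h] by blast
    obtain c2 where c2: "path_square (beyond (T - K)) (ray_seg h T T') (ray_seg g T T') (m \<circ> linepath ?a ?b) c2"
        "path_image c2 \<subseteq> beyond (T' - 1)"
      using piece[OF h(1) Suc.prems(2) h(2) Suc.prems(3) ab] by blast
    note sq = path_square_join_horizontal[OF c1(1) c2(1)]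
    have "homotopic_paths (beyond (T - K)) (m \<circ> (linepath 0 ?a +++ linepath ?a ?b)) (m \<circ> linepath 0 ?b)"
    proof (rule homotopic_paths_convex_image[of "{0..1}"])
      show "continuous_on {0..1} m" using m(1) by (simp add: path_def)
      show "m ` {0..1} \<subseteq> beyond (T - K)"
        using m(2) K by (auto simp: path_image_def beyond_def)
    qed (use ab in \<open>auto simp: path_image_join closed_segment_eq_real_ivl split: if_splits\<close>)
    then have "path_square (beyond (T - K)) (ray_seg f T T') (ray_seg g T T') (m \<circ> linepath 0 ?b) (c1 +++ c2)"
      using sq by (intro path_square_homotopic[OF sq]) (auto simp: path_square_def path_compose_join)
    moreover have "path_image (c1 +++ c2) \<subseteq> beyond (T' - 1)"
      using c1(2) c2(2) by (meson order.trans path_image_join_subset Un_least)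
    ultimately show ?case by blast
  qed
  have "real N / real N = 1" using N by simp
  moreover have "m \<circ> linepath 0 1 = m" by (auto simp: linepath_def)
  ultimately show ?thesis
    using upto[OF order_refl fg(2)] fg(4) that by metis
qed

text \<open>Retract \<open>L\<close> radially to the sphere of radius \<open>T\<close>, then attach
  the squares leading from there out to \<open>T'\<close>. The sides first run in and then out along
  rays; after cancellation they stay beyond \<open>T'\<close>, because the ends of \<open>L\<close>
  do.\<close>

proposition push_outwards:
  assumes T: "T0 \<le> T" "T \<le> T'" and L: "path L" "path_image L \<subseteq> beyond T"
    and ends: "pathstart L \<in> beyond T'" "pathfinish L \<in> beyond T'"
  obtains c where "homotopic_paths (beyond (T - K)) L c" "path_image c \<subseteq> beyond (T' - 1)"
proof -
  have "T > 0" using T T0 by simp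
  define a b where "a = dist x0 (L 0)" and "b = dist x0 (L 1)"
  have ab: "T' \<le> a" "T' \<le> b"
    using ends by (simp_all add: a_def b_def beyond_def pathstart_def pathfinish_def)
  then have "L 0 \<noteq> x0" "L 1 \<noteq> x0"
    using T \<open>T > 0\<close> by (auto simp: a_def b_def)
  then obtain f g where f: "f \<in> rays" "f a = L 0" and g: "g \<in> rays" "g b = L 1"
    unfolding a_def b_def using ray_through by metis
  have Ls: "T \<le> dist x0 (L s)" if "s \<in> {0..1}" for s
    using L(2) that unfolding path_image_def beyond_def by blast
  \<comment> \<open>The fraction of the geodesic from \<open>x0\<close> to \<open>L s\<close> at
    which the distance from \<open>x0\<close> has moved linearly from its original value
    (\<open>v = 0\<close>) to \<open>T\<close> (\<open>v = 1\<close>).\<close>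
  define \<rho> where "\<rho> s v = (1 - v) + v * (T / dist x0 (L s))" for s v
  have \<rho>: "\<rho> s v \<in> {0..1}" "\<rho> s v * dist x0 (L s) = (1 - v) * dist x0 (L s) + v * T"
    if "s \<in> {0..1}" "v \<in> {0..1}" for s v
  proof -
    have d: "0 < dist x0 (L s)" "T \<le> dist x0 (L s)"
      using Ls[OF that(1)] \<open>T > 0\<close> by linarith+
    then have "0 \<le> T / dist x0 (L s)" "T / dist x0 (L s) \<le> 1"
      using \<open>T > 0\<close> by (simp_all add: divide_le_eq_1)
    then have "0 \<le> v * (T / dist x0 (L s))" "v * (T / dist x0 (L s)) \<le> v"
      using that(2) mult_left_le[of "T / dist x0 (L s)" v] mult_nonneg_nonneg[of v "T / dist x0 (L s)"]
      by (simp_all only: atLeastAtMost_iff)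
    then show "\<rho> s v \<in> {0..1}" using that(2) by (auto simp: \<rho>_def)
    show "\<rho> s v * dist x0 (L s) = (1 - v) * dist x0 (L s) + v * T"
      using d(1) by (simp add: \<rho>_def field_simps)
  qed
  let ?F = "\<lambda>z. geod x0 (L (fst z)) (\<rho> (fst z) (snd z))"
  have dF: "dist x0 (?F (s, v)) = (1 - v) * dist x0 (L s) + v * T" if "s \<in> {0..1}" "v \<in> {0..1}" for s v
    using dist_geod[of 0 "\<rho> s v" x0 "L s"] \<rho>[OF that] by simp
  have "continuous_on ({0..1} \<times> {0..1}) (\<lambda>z::real \<times> real. L (fst z))"
    using L(1) unfolding path_def by (rule continuous_on_compose2) (auto intro!: continuous_intros)
  moreover from this have "continuous_on ({0..1} \<times> {0..1}) (\<lambda>z::real \<times> real. \<rho> (fst z) (snd z))"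
    unfolding \<rho>_def using Ls \<open>T > 0\<close> by (intro continuous_intros) force+
  ultimately have "continuous_on ({0..1} \<times> {0..1}) ?F"
    by (intro continuous_on_geod continuous_on_const) (use \<rho>(1) in auto)
  moreover have "?F ` ({0..1} \<times> {0..1}) \<subseteq> beyond T"
  proof -
    have "T \<le> (1 - v) * dist x0 (L s) + v * T" if "s \<in> {0..1}" "v \<in> {0..1}" for s v
      using mult_left_mono[OF Ls[OF that(1)], of "1 - v"] that(2) by (simp add: algebra_simps)
    then show ?thesis using dF by (auto simp: beyond_def)
  qed
  moreover have "beyond T \<subseteq> beyond (T - K)" using K by (intro beyond_mono) simp
  ultimately have sq: "path_square (beyond (T - K)) (\<lambda>v. ?F (0, v)) (\<lambda>v. ?F (1, v)) (\<lambda>s. ?F (s, 0)) (\<lambda>s. ?F (s, 1))"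
    by (intro path_square_map) auto
  define m where "m = (\<lambda>s. ?F (s, 1))"
  have m: "path m" using sq by (simp add: path_square_def m_def)
  have "path_image m \<subseteq> sphere x0 T"
    using dF[of _ 1] by (auto simp: path_image_def m_def)
  have side: "?F (s, v) = h (linepath (dist x0 (L s)) T v)"
    if "h \<in> rays" "h (dist x0 (L s)) = L s" "s \<in> {0..1}" "v \<in> {0..1}" for h s v
  proof -
    let ?d = "dist x0 (L s)" and ?u = "linepath (dist x0 (L s)) T v"
    have d: "?d > 0" "T \<le> ?d" using Ls[of s] that(3) \<open>T > 0\<close> by auto
    have u: "T \<le> ?u" "?u \<le> ?d"
      using linepath_in_path[OF that(4), of ?d T] d by (auto simp: closed_segment_eq_real_ivl split: if_splits)
    have "\<rho> s v = ?u / ?d"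
      using \<rho>(2)[OF that(3,4)] d by (simp add: linepath_def field_simps)
    then show ?thesis
      using ray_geod[OF that(1), of ?u ?d] u \<open>T > 0\<close> that(2) by simp
  qed
  have "homotopic_paths (beyond (T - K)) (\<lambda>v. ?F (0, v)) (ray_seg f a T)"
    using side[OF f(1), of 0] f(2) sq
    by (intro homotopic_paths_eq) (auto simp: path_square_def ray_seg_def a_def)
  moreover have "homotopic_paths (beyond (T - K)) (\<lambda>v. ?F (1, v)) (ray_seg g b T)"
    using side[OF g(1), of 1] g(2) sq
    by (intro homotopic_paths_eq) (auto simp: path_square_def ray_seg_def b_def)
  moreover have "homotopic_paths (beyond (T - K)) (\<lambda>s. ?F (s, 0)) L"
    using sq by (intro homotopic_paths_eq) (auto simp: path_square_def \<rho>_def)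
  ultimately have sq1: "path_square (beyond (T - K)) (ray_seg f a T) (ray_seg g b T) L m"
    using sq by (intro path_square_homotopic[OF sq]) (auto simp: path_square_def m_def)
  have "f T = m 0" "g T = m 1"
    using sq1 by (simp_all add: path_square_def pathstart_def[of m] pathfinish_def[of m])
  then obtain c where c: "path_square (beyond (T - K)) (ray_seg f T T') (ray_seg g T T') m c"
      "path_image c \<subseteq> beyond (T' - 1)"
    using path_square_sphere[OF T m \<open>path_image m \<subseteq> sphere x0 T\<close> f(1) g(1)] by blast
  note sq2 = path_square_join_vertical[OF sq1 c(1)]
  have join: "homotopic_paths (beyond (T - K)) (ray_seg h r T +++ ray_seg h T T') (ray_seg h r T')"
    if "h \<in> rays" "T' \<le> r" for h r
    using that T \<open>T > 0\<close> K
    by (intro homotopic_paths_subset[OF homotopic_ray_seg_join[of h T]] beyond_mono) auto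
  let ?l = "ray_seg f a T'" and ?r = "ray_seg g b T'"
  have sq3: "path_square (beyond (T - K)) ?l ?r L c"
    using sq2 join[OF f(1) ab(1)] join[OF g(1) ab(2)]
    by (intro path_square_homotopic[OF sq2]) (auto simp: path_square_def)
  \<comment> \<open>Solving the square for its bottom \<open>L\<close>: all three remaining sides
    lie far out.\<close>
  have "homotopic_paths (beyond (T - K)) L ((L +++ ?r) +++ reversepath ?r)"
    using sq3 by (intro homotopic_paths_sym[OF homotopic_paths_cancel_right]) (auto simp: path_square_def)
  also have "homotopic_paths (beyond (T - K)) \<dots> ((?l +++ c) +++ reversepath ?r)"
    by (rule homotopic_paths_join) (use sq3 in \<open>auto simp: path_square_def\<close>)
  finally have "homotopic_paths (beyond (T - K)) L ((?l +++ c) +++ reversepath ?r)" .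
  moreover have "path_image ((?l +++ c) +++ reversepath ?r) \<subseteq> beyond (T' - 1)"
  proof -
    have "beyond T' \<subseteq> beyond (T' - 1)" by (intro beyond_mono) simp
    moreover have "path_image ?l \<subseteq> beyond T'" "path_image ?r \<subseteq> beyond T'"
      using f g ab T \<open>T > 0\<close> by (simp_all add: path_image_ray_seg)
    ultimately show ?thesis
      using c(2) by (intro order.trans[OF path_image_join_subset] Un_least) auto
  qed
  ultimately show ?thesis using that by blast
qed

end

section \<open>Proper homotopies\<close>

text \<open>Recuts a homotopy relative to end points into a square with prescribed left, bottom and
  right sides. For tending to infinity only the image of the top counts, so its parametrisation is
  left open.\<close>

lemma homotopic_paths_fill_square:
  fixes p1 p2 c :: "real \<Rightarrow> 'a::topological_space"
  assumes ends: "pathfinish p1 = pathstart c" "pathfinish c = pathstart p2"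
    and h: "homotopic_paths S (p1 +++ (c +++ p2)) c'"
  obtains F where "continuous_on ({0..1} \<times> {0..1}) F" "F ` ({0..1} \<times> {0..1}) \<subseteq> S"
    "\<And>u. u \<in> {0..1} \<Longrightarrow> F (u, 0) = c u" "\<And>u. u \<in> {0..1} \<Longrightarrow> F (u, 1) \<in> path_image c'"
    "\<And>v. v \<in> {0..1} \<Longrightarrow> F (0, v) = p1 (1 - v)" "\<And>v. v \<in> {0..1} \<Longrightarrow> F (1, v) = p2 v"
proof -
  let ?L = "p1 +++ (c +++ p2)"
  let ?W = "{0..1::real} \<times> {0..1::real}"
  obtain H where H: "continuous_on ?W H" "H \<in> ?W \<rightarrow> S"
      "\<And>x. x \<in> {0..1} \<Longrightarrow> H (0, x) = ?L x" "\<And>x. x \<in> {0..1} \<Longrightarrow> H (1, x) = c' x"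
      "\<And>y. y \<in> {0..1} \<Longrightarrow> H (y, 0) = ?L 0 \<and> H (y, 1) = ?L 1"
    using h unfolding homotopic_paths by (auto simp: pathstart_def pathfinish_def)
  have c': "c' 0 = ?L 0" "c' 1 = ?L 1"
    using homotopic_paths_imp_pathstart[OF h] homotopic_paths_imp_pathfinish[OF h]
    by (simp_all only: pathstart_def pathfinish_def)
  \<comment> \<open>The reparametrisation \<open>(X, Y)\<close> maps the left, bottom and right side of the square onto the
    consecutive intervals \<open>[0, 1/2]\<close>, \<open>[1/2, 3/4]\<close>, \<open>[3/4, 1]\<close> of the side where \<open>H\<close> is \<open>p1 +++ (c +++ p2)\<close>,
    and the top onto the other three sides, where \<open>H\<close> has its values on \<open>c'\<close>.\<close>
  define clamp :: "real \<Rightarrow> real" where "clamp x = max 0 (min 1 x)" for x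
  define X where "X u v = (1 - v) * (1/2 + u/4) + v * clamp (3 * u - 1)" for u v
  define Y where "Y u v = v * clamp (min (3 * u) (3 - 3 * u))" for u v
  have clamp: "0 \<le> clamp x" "clamp x \<le> 1" for x by (auto simp: clamp_def)
  have XY: "X u v \<in> {0..1}" "Y u v \<in> {0..1}" if "u \<in> {0..1}" "v \<in> {0..1}" for u v
  proof -
    have "X u v \<le> (1 - v) * 1 + v * 1"
      unfolding X_def using that clamp by (intro add_mono mult_left_mono) auto
    moreover have "0 \<le> X u v"
      unfolding X_def using that clamp by (intro add_nonneg_nonneg mult_nonneg_nonneg) auto
    ultimately show "X u v \<in> {0..1}" by simp
    show "Y u v \<in> {0..1}"
      unfolding Y_def using that clamp by (auto intro: mult_le_one)
  qed
  let ?F = "\<lambda>z. H (Y (fst z) (snd z), X (fst z) (snd z))"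
  show ?thesis
  proof (rule that[of ?F])
    have "continuous_on ?W (\<lambda>z. (Y (fst z) (snd z), X (fst z) (snd z)))"
      unfolding X_def Y_def clamp_def by (intro continuous_intros) auto
    then show "continuous_on ?W ?F"
      by (rule continuous_on_compose2[OF H(1)]) (use XY in auto)
    show "?F ` ?W \<subseteq> S"
      using H(2) XY by (auto simp: Pi_iff)
  next
    fix u :: real assume u: "u \<in> {0..1}"
    have "?F (u, 0) = ?L (1/2 + u/4)"
      using H(3)[of "1/2 + u/4"] u by (simp add: X_def Y_def)
    also have "\<dots> = c u"
      using u ends by (cases "u = 0") (auto simp: joinpaths_def pathstart_def pathfinish_def)
    finally show "?F (u, 0) = c u" .
    have im: "c' x \<in> path_image c'" if "x \<in> {0..1}" for x
      using that by (simp add: path_image_def)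
    consider "u \<le> 1/3" | "2/3 \<le> u" | "1/3 \<le> u" "u \<le> 2/3" by linarith
    then show "?F (u, 1) \<in> path_image c'"
    proof cases
      case 1
      then have "X u 1 = 0" by (simp add: X_def clamp_def)
      then have "?F (u, 1) = c' 0" using H(5) XY[OF u, of 1] c' by simp
      then show ?thesis using im[of 0] by simp
    next
      case 2
      then have "X u 1 = 1" by (simp add: X_def clamp_def)
      then have "?F (u, 1) = c' 1" using H(5) XY[OF u, of 1] c' by simp
      then show ?thesis using im[of 1] by simp
    next
      case 3
      then have "Y u 1 = 1" by (simp add: Y_def clamp_def)
      then show ?thesis using H(4) XY[OF u, of 1] im by simp
    qed
  next
    fix v :: real assume v: "v \<in> {0..1}"
    have "?F (0, v) = ?L ((1 - v) / 2)"
      using H(3)[of "(1 - v) / 2"] v by (simp add: X_def Y_def clamp_def)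
    also have "\<dots> = p1 (1 - v)"
    proof -
      have "(1 - v) / 2 \<le> 1 / 2" "2 * ((1 - v) / 2) = 1 - v" using v by auto
      then show ?thesis by (simp only: joinpaths_def if_True)
    qed
    finally show "?F (0, v) = p1 (1 - v)" .
    have "X 1 v = 3/4 + v/4" "Y 1 v = 0"
      by (simp_all add: X_def Y_def clamp_def field_simps)
    then have "?F (1, v) = ?L (3/4 + v/4)"
      using H(3)[of "3/4 + v/4"] v by simp
    also have "\<dots> = p2 v"
    proof (cases "v = 0")
      case True
      then show ?thesis using ends by (simp add: joinpaths_def pathstart_def pathfinish_def)
    next
      case False
      then have "?L (3/4 + v/4) = (c +++ p2) (1/2 + v/2)"
        using v by (simp add: joinpaths_def[of p1])
      also have "\<dots> = p2 v"
        using False v by (simp add: joinpaths_def)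
      finally show ?thesis .
    qed
    finally show "?F (1, v) = p2 v" .
  qed
qed

lemma homotopic_paths_fill_strip:
  fixes r1 r2 c :: "real \<Rightarrow> 'a::topological_space"
  assumes "a < b" and ends: "pathstart c = r1 a" "pathfinish c = r2 a"
    and h: "homotopic_paths S ((r1 \<circ> linepath b a) +++ (c +++ (r2 \<circ> linepath a b))) c'"
  obtains G where "continuous_on ({0..1} \<times> {a..b}) G" "G ` ({0..1} \<times> {a..b}) \<subseteq> S"
    "\<And>u. u \<in> {0..1} \<Longrightarrow> G (u, a) = c u" "\<And>u. u \<in> {0..1} \<Longrightarrow> G (u, b) \<in> path_image c'"
    "\<And>t. t \<in> {a..b} \<Longrightarrow> G (0, t) = r1 t" "\<And>t. t \<in> {a..b} \<Longrightarrow> G (1, t) = r2 t"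
proof -
  obtain F where F: "continuous_on ({0..1} \<times> {0..1}) F" "F ` ({0..1} \<times> {0..1}) \<subseteq> S"
    "\<And>u. u \<in> {0..1} \<Longrightarrow> F (u, 0) = c u" "\<And>u. u \<in> {0..1} \<Longrightarrow> F (u, 1) \<in> path_image c'"
    "\<And>v. v \<in> {0..1} \<Longrightarrow> F (0, v) = (r1 \<circ> linepath b a) (1 - v)"
    "\<And>v. v \<in> {0..1} \<Longrightarrow> F (1, v) = (r2 \<circ> linepath a b) v"
    using homotopic_paths_fill_square[OF _ _ h] ends
    by (auto simp: pathstart_compose pathfinish_compose)
  define \<phi> where "\<phi> t = (t - a) / (b - a)" for t
  have \<phi>: "\<phi> t \<in> {0..1}" "linepath a b (\<phi> t) = t" "linepath b a (1 - \<phi> t) = t" if "t \<in> {a..b}" for t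
  proof -
    show "\<phi> t \<in> {0..1}" using that \<open>a < b\<close> by (simp add: \<phi>_def divide_le_eq_1)
    have "\<phi> t * (b - a) = t - a" using \<open>a < b\<close> by (simp add: \<phi>_def)
    then show "linepath a b (\<phi> t) = t" "linepath b a (1 - \<phi> t) = t"
      by (simp_all add: linepath_def algebra_simps)
  qed
  have \<phi>_ends: "\<phi> a = 0" "\<phi> b = 1" using \<open>a < b\<close> by (simp_all add: \<phi>_def)
  let ?G = "\<lambda>z. F (fst z, \<phi> (snd z))"
  show ?thesis
  proof (rule that[of ?G])
    have "continuous_on ({0..1} \<times> {a..b}) (\<lambda>z. (fst z, \<phi> (snd z)))"
      unfolding \<phi>_def using \<open>a < b\<close> by (intro continuous_intros) auto
    then show "continuous_on ({0..1} \<times> {a..b}) ?G"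
      by (rule continuous_on_compose2[OF F(1)]) (use \<phi>(1) in \<open>auto simp del: atLeastAtMost_iff\<close>)
    show "?G ` ({0..1} \<times> {a..b}) \<subseteq> S"
      using F(2) \<phi>(1) by (force simp del: atLeastAtMost_iff)
  qed (use F \<phi> \<phi>_ends in \<open>auto simp del: atLeastAtMost_iff\<close>)
qed

lemma exists_bracketing_interval:
  fixes a :: "nat \<Rightarrow> 'a::linorder"
  assumes "\<And>x. \<exists>n. x < a n" "a 0 \<le> t"
  shows "\<exists>n. t \<in> {a n..a (Suc n)}"
proof -
  define n where "n = (LEAST n. t < a n)"
  have n: "t < a n" unfolding n_def by (rule LeastI_ex) (rule assms(1))
  then obtain m where m: "n = Suc m" using assms(2) by (cases n) auto
  then have "\<not> t < a m" using not_less_Least[of m "\<lambda>n. t < a n"] by (simp add: n_def)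
  then show ?thesis using n m by (intro exI[of _ m]) auto
qed

text \<open>The strips are closed, and locally finite because \<open>a\<close> is unbounded.\<close>

lemma paste_strips:
  fixes a :: "nat \<Rightarrow> real" and G :: "nat \<Rightarrow> real \<times> real \<Rightarrow> 'a::topological_space"
  assumes a: "strict_mono a" "\<And>x. \<exists>n. x < a n"
    and cont: "\<And>n. continuous_on ({0..1} \<times> {a n..a (Suc n)}) (G n)"
    and agree: "\<And>n s. s \<in> {0..1} \<Longrightarrow> G n (s, a (Suc n)) = G (Suc n) (s, a (Suc n))"
  obtains H where "continuous_on ({0..1} \<times> {a 0..}) H"
    "\<forall>n. \<forall>z\<in>{0..1} \<times> {a n..a (Suc n)}. H z = G n z"
proof -
  let ?X = "{0..1::real} \<times> {a 0..}"
  let ?T = "\<lambda>n. {0..1::real} \<times> {a n..a (Suc n)}"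
  have le: "a m \<le> a n \<longleftrightarrow> m \<le> n" for m n
    using a(1) by (rule strict_mono_less_eq)
  have sub: "?T n \<subseteq> ?X" for n
    using le[of 0 n] by auto
  \<comment> \<open>Two strips with a common point are consecutive, and the point lies on their
    common edge.\<close>
  have eq: "G i x = G j x" if "i < j" "x \<in> ?T i" "x \<in> ?T j" for i j x
  proof -
    obtain s t where x: "x = (s, t)" by (cases x)
    have "a (Suc i) \<le> a j" using \<open>i < j\<close> le by simp
    then have t: "t = a (Suc i)" "a j \<le> a (Suc i)" using that x by auto
    then have "j = Suc i" using le[of j "Suc i"] \<open>i < j\<close> by simp
    then show ?thesis using agree[of s i] that x t by simp
  qed
  obtain H where H: "continuous_map (top_of_set ?X) euclidean H"
      "\<And>x i. i \<in> UNIV \<Longrightarrow> x \<in> topspace (top_of_set ?X) \<inter> ?T i \<Longrightarrow> H x = G i x"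
  proof (rule pasting_lemma_exists_locally_finite[of "top_of_set ?X" UNIV ?T euclidean G "\<lambda>x. G (SOME i. x \<in> ?T i) x"])
    have cover: "\<exists>i. x \<in> ?T i" if x: "x \<in> ?X" for x
      using exists_bracketing_interval[OF a(2), of "snd x"] x by (auto simp: mem_Times_iff)
    show "topspace (top_of_set ?X) \<subseteq> \<Union> (?T ` UNIV)"
      using cover by auto
    show "\<exists>j. j \<in> UNIV \<and> x \<in> ?T j \<and> G (SOME i. x \<in> ?T i) x = G j x" if "x \<in> topspace (top_of_set ?X)" for x
      using someI_ex[OF cover[of x]] that by auto
    show "\<exists>V. openin (top_of_set ?X) V \<and> x \<in> V \<and> finite {i \<in> UNIV. ?T i \<inter> V \<noteq> {}}"
      if "x \<in> topspace (top_of_set ?X)" for x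
    proof -
      obtain N where N: "snd x < a N" using a(2) by blast
      let ?V = "?X \<inter> (UNIV \<times> {..<a N})"
      have "openin (top_of_set ?X) ?V"
        by (intro openin_open_Int open_Times) auto
      moreover have "x \<in> ?V" using that N by (cases x) auto
      moreover have "i < N" if "?T i \<inter> ?V \<noteq> {}" for i
      proof -
        have "a i < a N" using that by auto
        then show ?thesis using le[of N i] by (meson not_less)
      qed
      then have "{i \<in> UNIV. ?T i \<inter> ?V \<noteq> {}} \<subseteq> {..<N}" by blast
      then have "finite {i \<in> UNIV. ?T i \<inter> ?V \<noteq> {}}" using finite_subset by blast
      ultimately show ?thesis by blast
    qed
    show "closedin (top_of_set ?X) (?T i)" for i
      using sub by (intro closed_subset closed_Times) auto
    show "continuous_map (subtopology (top_of_set ?X) (?T i)) euclidean (G i)" for i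
      using cont[of i] sub[of i] by (simp add: subtopology_subtopology Int_absorb1)
    show "G i x = G j x" if "x \<in> topspace (top_of_set ?X) \<inter> ?T i \<inter> ?T j" for i j x
    proof -
      have "x \<in> ?T i" "x \<in> ?T j" using that by blast+
      then show ?thesis
        using eq[of i j x] eq[of j i x] by (metis linorder_neqE_nat)
    qed
  qed auto
  show ?thesis
  proof (rule that[of H])
    show "continuous_on ?X H" using H(1) by simp
    have "H z = G n z" if "z \<in> ?T n" for n z
      using H(2)[of n z] sub[of n] that by auto
    then show "\<forall>n. \<forall>z\<in>?T n. H z = G n z" by blast
  qed
qed

context cat0
begin

lemma compact_bounded_dist:
  assumes "compact (C :: 'a set)"
  obtains R where "C \<subseteq> cball x0 R"
  using compact_imp_bounded[OF assms] bounded_any_center[of C x0] by (auto simp: subset_iff)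

end

context complete_cat0
begin

lemma proper_ray_leaves:
  assumes "proper_ray (r :: real \<Rightarrow> 'a)"
  obtains N where "\<And>t. N \<le> t \<Longrightarrow> r t \<in> beyond R" "0 \<le> N"
proof -
  have "compact ({0..} \<inter> r -` cball x0 R)"
    using assms proper unfolding proper_ray_def proper_space_def by blast
  then obtain B where B: "\<And>t. t \<in> {0..} \<inter> r -` cball x0 R \<Longrightarrow> \<bar>t\<bar> \<le> B"
    using compact_imp_bounded bounded_real by metis
  show ?thesis
  proof (rule that[of "\<bar>B\<bar> + 1"])
    fix t assume t: "\<bar>B\<bar> + 1 \<le> t"
    show "r t \<in> beyond R"
    proof (rule ccontr)
      assume "r t \<notin> beyond R"
      then have "\<bar>t\<bar> \<le> B" using t by (intro B) (auto simp: beyond_def)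
      then show False using t by linarith
    qed
  qed auto
qed

end

section \<open>Proper rays with the same end\<close>

context refining
begin

definition joins :: "(real \<Rightarrow> 'a) \<Rightarrow> (real \<Rightarrow> 'a) \<Rightarrow> real \<Rightarrow> real \<Rightarrow> (real \<Rightarrow> 'a) \<Rightarrow> bool" where
  "joins r1 r2 t R c \<longleftrightarrow> path c \<and> pathstart c = r1 t \<and> pathfinish c = r2 t \<and> path_image c \<subseteq> beyond R"

definition strip :: "(real \<Rightarrow> 'a) \<Rightarrow> (real \<Rightarrow> 'a) \<Rightarrow> real \<Rightarrow> real \<Rightarrow> 'a set \<Rightarrow> (real \<times> real \<Rightarrow> 'a) \<Rightarrow> bool" where
  "strip r1 r2 a b S G \<longleftrightarrow> continuous_on ({0..1} \<times> {a..b}) G \<and> G ` ({0..1} \<times> {a..b}) \<subseteq> S \<and>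
     (\<forall>t\<in>{a..b}. G (0, t) = r1 t \<and> G (1, t) = r2 t)"

text \<open>\<open>push_outwards\<close> needs end points beyond \<open>T'\<close>, which those of
  \<open>c\<close> may fail to be. It is applied to the path that comes in along \<open>r1\<close>
  from time \<open>b\<close>, follows \<open>c\<close> and leaves along \<open>r2\<close>.\<close>

lemma strip_outwards:
  assumes T: "T0 \<le> T" "T \<le> T'" and ab: "0 \<le> a" "a < b"
    and r: "continuous_on {0..} r1" "continuous_on {0..} r2"
    and far: "\<And>t. a \<le> t \<Longrightarrow> r1 t \<in> beyond T" "\<And>t. a \<le> t \<Longrightarrow> r2 t \<in> beyond T"
      "r1 b \<in> beyond T'" "r2 b \<in> beyond T'"
    and c: "joins r1 r2 a T c"
  obtains c' G where "joins r1 r2 b (T' - 1) c'" "strip r1 r2 a b (beyond (T - K)) G"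
    "\<forall>s\<in>{0..1}. G (s, a) = c s \<and> G (s, b) = c' s"
proof -
  let ?q1 = "r1 \<circ> linepath b a" and ?q2 = "r2 \<circ> linepath a b"
  let ?L = "?q1 +++ (c +++ ?q2)"
  have path: "path (r \<circ> linepath x y)" if "continuous_on {0..} r" "x \<in> {a..b}" "y \<in> {a..b}" for r x y
    by (rule path_compose_linepath, rule continuous_on_subset[OF that(1)])
      (use that ab in \<open>auto simp: closed_segment_eq_real_ivl split: if_splits\<close>)
  have image: "path_image (r \<circ> linepath x y) \<subseteq> beyond T"
    if "\<And>t. a \<le> t \<Longrightarrow> r t \<in> beyond T" "x \<in> {a..b}" "y \<in> {a..b}" for r x y
    using that by (auto simp: path_image_compose closed_segment_eq_real_ivl split: if_splits)
  have ends: "pathfinish ?q1 = pathstart c" "pathfinish c = pathstart ?q2"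
    using c by (simp_all add: joins_def pathstart_compose pathfinish_compose)
  have "path ?L"
    using path[OF r(1), of b a] path[OF r(2), of a b] c ab ends by (auto simp: joins_def)
  moreover have "path_image ?L \<subseteq> beyond T"
  proof (intro order.trans[OF path_image_join_subset] Un_least)
    show "path_image ?q1 \<subseteq> beyond T" by (rule image) (use far ab in auto)
    show "path_image ?q2 \<subseteq> beyond T" by (rule image) (use far ab in auto)
    show "path_image c \<subseteq> beyond T" using c by (simp add: joins_def)
  qed
  moreover have "pathstart ?L \<in> beyond T'" "pathfinish ?L \<in> beyond T'"
    using far by (simp_all add: pathstart_compose pathfinish_compose)
  ultimately obtain e where e: "homotopic_paths (beyond (T - K)) ?L e" "path_image e \<subseteq> beyond (T' - 1)"
    by (rule push_outwards[OF T])
  have c_ends: "pathstart c = r1 a" "pathfinish c = r2 a"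
    using c by (simp_all add: joins_def)
  obtain G where G: "continuous_on ({0..1} \<times> {a..b}) G" "G ` ({0..1} \<times> {a..b}) \<subseteq> beyond (T - K)"
    "\<And>u. u \<in> {0..1} \<Longrightarrow> G (u, a) = c u" "\<And>u. u \<in> {0..1} \<Longrightarrow> G (u, b) \<in> path_image e"
    "\<And>t. t \<in> {a..b} \<Longrightarrow> G (0, t) = r1 t" "\<And>t. t \<in> {a..b} \<Longrightarrow> G (1, t) = r2 t"
    using homotopic_paths_fill_strip[OF ab(2) c_ends e(1)] by blast
  have "path (\<lambda>s. G (s, b))"
    unfolding path_def
    by (rule continuous_on_compose2[OF G(1)]) (use ab in \<open>auto intro!: continuous_intros\<close>)
  then have "joins r1 r2 b (T' - 1) (\<lambda>s. G (s, b))"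
    using G(4,5,6) e(2) ab unfolding joins_def path_image_def pathstart_def pathfinish_def by auto
  moreover have "strip r1 r2 a b (beyond (T - K)) G"
    using G by (simp add: strip_def)
  ultimately show ?thesis using that G by blast
qed

lemma properly_homotopic_same_end:
  assumes r: "proper_ray r1" "proper_ray r2" and same: "same_end r1 r2"
  shows "properly_homotopic r1 (r2 :: real \<Rightarrow> 'a)"
proof -
  have cont: "continuous_on {0..} r1" "continuous_on {0..} r2"
    using r by (simp_all add: proper_ray_def)
  let ?R = "\<lambda>n. T0 + real n"
  \<comment> \<open>The extra 1 pays for the loss in \<open>strip_outwards\<close>: pushing out to
    \<open>?R (Suc n) + 1\<close> gives a path beyond \<open>?R (Suc n)\<close>.\<close>
  have "\<exists>N\<ge>0. \<forall>t\<ge>N. r1 t \<in> beyond (?R n + 1) \<and> r2 t \<in> beyond (?R n + 1)" for n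
  proof -
    obtain N1 where "\<And>t. N1 \<le> t \<Longrightarrow> r1 t \<in> beyond (?R n + 1)" "0 \<le> N1"
      using proper_ray_leaves[OF r(1)] by blast
    moreover obtain N2 where "\<And>t. N2 \<le> t \<Longrightarrow> r2 t \<in> beyond (?R n + 1)" "0 \<le> N2"
      using proper_ray_leaves[OF r(2)] by blast
    ultimately show ?thesis by (intro exI[of _ "max N1 N2"]) auto
  qed
  then obtain A where A: "\<And>n. 0 \<le> A n" "\<And>n t. A n \<le> t \<Longrightarrow> r1 t \<in> beyond (?R n + 1) \<and> r2 t \<in> beyond (?R n + 1)"
    by metis
  have "compact (cball x0 T0)" using proper by (simp add: proper_space_def)
  from same[unfolded same_end_def, THEN spec, THEN mp, OF this]
  obtain N where N: "N \<ge> 0" "\<forall>s\<ge>N. \<forall>t\<ge>N. path_component (- cball x0 T0) (r1 s) (r2 t)"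
    by auto
  \<comment> \<open>Past \<open>N\<close>, so that the rays can be joined at time
    \<open>b 0\<close>; past \<open>A n\<close>, so that they are far out; and growing by at least
    1, so that the times are unbounded.\<close>
  define b where "b = rec_nat (N + A 0 + 1) (\<lambda>n t. max (t + 1) (A (Suc n)))"
  have b0: "b 0 = N + A 0 + 1" and bSuc: "b (Suc n) = max (b n + 1) (A (Suc n))" for n
    by (simp_all add: b_def)
  have bA: "A n \<le> b n" for n
    by (cases n) (use N A(1)[of 0] in \<open>auto simp: b0 bSuc\<close>)
  have b_less: "b n < b (Suc n)" for n by (simp add: bSuc)
  have b_ge: "real n + 1 \<le> b n" for n
    by (induction n) (use N A(1)[of 0] in \<open>auto simp: b0 bSuc\<close>)
  have far: "r1 t \<in> beyond (?R n + 1)" "r2 t \<in> beyond (?R n + 1)" if "b n \<le> t" for n t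
    using A(2)[of n t] bA[of n] that by auto
  have "\<exists>c. joins r1 r2 (b 0) (?R 0) c"
  proof -
    have "path_component (- cball x0 T0) (r1 (b 0)) (r2 (b 0))"
      using A(1)[of 0] N(2) by (simp add: b0)
    then obtain c where c: "path c" "path_image c \<subseteq> - cball x0 T0" "pathstart c = r1 (b 0)" "pathfinish c = r2 (b 0)"
      unfolding path_component_def by blast
    have "- cball x0 T0 \<subseteq> beyond (?R 0)" by (auto simp: beyond_def)
    then have "joins r1 r2 (b 0) (?R 0) c"
      using c unfolding joins_def by blast
    then show ?thesis by blast
  qed
  moreover have "\<exists>c'. joins r1 r2 (b (Suc n)) (?R (Suc n)) c' \<and>
      (\<exists>G. strip r1 r2 (b n) (b (Suc n)) (beyond (?R n - K)) G \<and>
        (\<forall>s\<in>{0..1}. G (s, b n) = c s \<and> G (s, b (Suc n)) = c' s))"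
    if c: "joins r1 r2 (b n) (?R n) c" for n c
  proof -
    have mono: "beyond (?R n + 1) \<subseteq> beyond (?R n)" by (intro beyond_mono) simp
    have T: "T0 \<le> ?R n" "?R n \<le> ?R (Suc n) + 1" and b: "0 \<le> b n"
      using b_ge[of n] by simp_all
    have far_n: "r1 t \<in> beyond (?R n)" "r2 t \<in> beyond (?R n)" if "b n \<le> t" for t
      using far[OF that] mono by auto
    have "b (Suc n) \<le> b (Suc n)" by simp
    note far_b = far[OF this]
    obtain c' G where "joins r1 r2 (b (Suc n)) (?R (Suc n) + 1 - 1) c'"
      "strip r1 r2 (b n) (b (Suc n)) (beyond (?R n - K)) G"
      "\<forall>s\<in>{0..1}. G (s, b n) = c s \<and> G (s, b (Suc n)) = c' s"
      by (rule strip_outwards[OF T b b_less cont far_n far_b c])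
    moreover have "?R (Suc n) + 1 - 1 = ?R (Suc n)" by simp
    ultimately show ?thesis by metis
  qed
  ultimately obtain c where c: "\<And>n. joins r1 r2 (b n) (?R n) (c n) \<and>
      (\<exists>G. strip r1 r2 (b n) (b (Suc n)) (beyond (?R n - K)) G \<and>
        (\<forall>s\<in>{0..1}. G (s, b n) = c n s \<and> G (s, b (Suc n)) = c (Suc n) s))"
    using dependent_nat_choice[of "\<lambda>n. joins r1 r2 (b n) (?R n)" "\<lambda>n c c'. \<exists>G.
        strip r1 r2 (b n) (b (Suc n)) (beyond (?R n - K)) G \<and>
        (\<forall>s\<in>{0..1}. G (s, b n) = c s \<and> G (s, b (Suc n)) = c' s)"] by blast
  then have "\<forall>n. \<exists>G. strip r1 r2 (b n) (b (Suc n)) (beyond (?R n - K)) G \<and>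
        (\<forall>s\<in>{0..1}. G (s, b n) = c n s \<and> G (s, b (Suc n)) = c (Suc n) s)" by blast
  from choice[OF this] obtain G where G: "\<And>n. strip r1 r2 (b n) (b (Suc n)) (beyond (?R n - K)) (G n)"
      "\<And>n s. s \<in> {0..1} \<Longrightarrow> G n (s, b n) = c n s" "\<And>n s. s \<in> {0..1} \<Longrightarrow> G n (s, b (Suc n)) = c (Suc n) s"
    by blast
  \<comment> \<open>The strip over the initial times is filled in the whole space, by a constant
    homotopy. The filling lemma places \<open>c 0\<close> at the earliest time, so the rays are run
    backwards from \<open>B\<close> and the result is flipped.\<close>
  obtain G0 where G0: "strip r1 r2 0 (b 0) UNIV G0" "\<And>s. s \<in> {0..1} \<Longrightarrow> G0 (s, b 0) = c 0 s"
  proof -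
    define B where "B = b 0"
    have B: "0 < B" using N A(1)[of 0] by (simp add: b0 B_def)
    let ?p1 = "\<lambda>t. r1 (B - t)" and ?p2 = "\<lambda>t. r2 (B - t)"
    let ?L = "(?p1 \<circ> linepath B 0) +++ (c 0 +++ (?p2 \<circ> linepath 0 B))"
    have c0: "path (c 0)" "pathstart (c 0) = ?p1 0" "pathfinish (c 0) = ?p2 0"
      using c[of 0] by (simp_all add: joins_def B_def)
    have p: "path ((\<lambda>t. r (B - t)) \<circ> linepath x y)"
      if "continuous_on {0..} r" "x \<in> {0..B}" "y \<in> {0..B}" for r :: "real \<Rightarrow> 'a" and x y
    proof (rule path_compose_linepath, rule continuous_on_compose2[OF that(1)])
      show "continuous_on (closed_segment x y) ((-) B)" by (intro continuous_intros)
      show "(-) B ` closed_segment x y \<subseteq> {0..}"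
        using that by (auto simp: closed_segment_eq_real_ivl split: if_splits)
    qed
    have "path ?L"
      using p[OF cont(1), of B 0] p[OF cont(2), of 0 B] B c0
      by (simp add: pathstart_compose pathfinish_compose)
    then have "homotopic_paths UNIV ?L ?L" by simp
    from homotopic_paths_fill_strip[OF B c0(2,3) this]
    obtain F where F: "continuous_on ({0..1} \<times> {0..B}) F" "F ` ({0..1} \<times> {0..B}) \<subseteq> UNIV"
        "\<And>u. u \<in> {0..1} \<Longrightarrow> F (u, 0) = c 0 u" "\<And>u. u \<in> {0..1} \<Longrightarrow> F (u, B) \<in> path_image ?L"
        "\<And>t. t \<in> {0..B} \<Longrightarrow> F (0, t) = ?p1 t" "\<And>t. t \<in> {0..B} \<Longrightarrow> F (1, t) = ?p2 t"
      by blast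
    have "continuous_on ({0..1} \<times> {0..B}) (\<lambda>z. F (fst z, B - snd z))"
      by (rule continuous_on_compose2[OF F(1)]) (auto intro!: continuous_intros)
    then show ?thesis
      using F by (intro that[of "\<lambda>z. F (fst z, B - snd z)"]) (auto simp: strip_def B_def)
  qed
  define a where "a = case_nat 0 b"
  define E where "E = case_nat G0 G"
  have a_Suc: "a 0 = 0" "a (Suc n) = b n" for n by (simp_all add: a_def)
  have "a n < a (Suc n)" for n
    by (cases n) (use b_less b_ge[of 0] in \<open>auto simp: a_def\<close>)
  then have mono_a: "strict_mono a" by (rule strict_mono_Suc_iff[THEN iffD2, rule_format])
  have ex: "\<exists>n. x < a n" for x
  proof -
    obtain n :: nat where "x < real n" using reals_Archimedean2 by blast
    then have "x < a (Suc n)" using b_ge[of n] by (simp add: a_Suc)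
    then show ?thesis by blast
  qed
  have E: "strip r1 r2 (a n) (a (Suc n)) UNIV (E n)" for n
    using G0 G(1) by (cases n) (auto simp: a_def E_def strip_def)
  then have contE: "continuous_on ({0..1} \<times> {a n..a (Suc n)}) (E n)" for n
    by (simp add: strip_def)
  have agree: "E n (s, a (Suc n)) = E (Suc n) (s, a (Suc n))" if "s \<in> {0..1}" for n s
    using G0(2) G(2,3) that by (cases n) (auto simp: a_def E_def)
  obtain H where H: "continuous_on ({0..1} \<times> {a 0..}) H"
      "\<forall>n. \<forall>z\<in>{0..1} \<times> {a n..a (Suc n)}. H z = E n z"
    by (rule paste_strips[of a E, OF mono_a ex contE agree])
  have index: "\<exists>n. t \<in> {a n..a (Suc n)}" if "0 \<le> t" for t
    using exists_bracketing_interval[of a t] ex that by (simp add: a_Suc)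
  show ?thesis
    unfolding properly_homotopic_def
  proof (intro exI[of _ H] conjI allI impI)
    show contH: "continuous_on ({0..1} \<times> {0..}) H"
      using H(1) by (simp add: a_Suc)
    show "compact (({0..1} \<times> {0..}) \<inter> H -` C)" if "compact C" for C
    proof -
      obtain R where R: "C \<subseteq> cball x0 R"
        using compact_bounded_dist[OF \<open>compact C\<close>] .
      \<comment> \<open>From index \<open>m\<close> on, the strips lie beyond
        \<open>T0 + real m - K\<close>, hence outside the ball that contains
        \<open>C\<close>.\<close>
      obtain m :: nat where m: "R + K < real m" using reals_Archimedean2 by blast
      have closed: "closed (({0..1} \<times> {0..}) \<inter> H -` C)"
        using contH compact_imp_closed[OF that]
        by (intro continuous_closed_preimage closed_Times) auto
      have "({0..1} \<times> {0..}) \<inter> H -` C \<subseteq> {0..1} \<times> {0..b m}"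
      proof
        fix z assume z: "z \<in> ({0..1} \<times> {0..}) \<inter> H -` C"
        obtain s t where st: "z = (s, t)" by (cases z)
        show "z \<in> {0..1} \<times> {0..b m}"
        proof (rule ccontr)
          assume "z \<notin> {0..1} \<times> {0..b m}"
          then have t: "b m < t" "0 \<le> t" using z st by auto
          then obtain n where n: "t \<in> {a n..a (Suc n)}" using index by blast
          then have "a (Suc m) < a (Suc n)" using t by (simp add: a_Suc)
          then have "m < n" using mono_a by (simp add: strict_mono_less)
          then obtain k where k: "n = Suc k" "m \<le> k" by (cases n) auto
          have z': "z \<in> {0..1} \<times> {b k..b (Suc k)}" using n k z st by (auto simp: a_Suc)
          then have "H z = G k z" using H(2)[THEN spec[of _ n]] k by (auto simp: a_Suc E_def)
          then have "H z \<in> beyond (?R k - K)" using G(1)[of k] z' unfolding strip_def by auto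
          moreover have "dist x0 (H z) \<le> R" using z R by auto
          ultimately have "T0 + real k - K \<le> R" by (simp add: beyond_def)
          then show False using m k(2) T0 by linarith
        qed
      qed
      then have "({0..1} \<times> {0..}) \<inter> H -` C = ({0..1} \<times> {0..b m}) \<inter> (({0..1} \<times> {0..}) \<inter> H -` C)"
        by blast
      also have "compact \<dots>"
        by (intro compact_Int_closed compact_Times compact_Icc closed)
      finally show ?thesis .
    qed
    fix t :: real assume "t \<ge> 0"
    then obtain n where n: "t \<in> {a n..a (Suc n)}" using index by blast
    then show "H (0, t) = r1 t" "H (1, t) = r2 t"
      using H(2)[THEN spec[of _ n]] E[of n] by (auto simp: strip_def)
  qed
qed

end

text \<open>Weak chainedness includes chain connectedness, which for a compact space means
  connectedness, so the first conclusion is stated for a connected boundary; semistability covers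
  every end. The limit condition is read as a lower limit from the right.\<close>

theorem theorem3:
  fixes x0 :: "'a::metric_space" and K :: real and \<iota> :: "real \<Rightarrow> real"
  assumes "proper_space TYPE('a)"
    and "geodesically_complete TYPE('a)"
    and "CAT0 TYPE('a)"
    and "K > 0"
    and "\<And>t. t > 0 \<Longrightarrow> \<iota> t > 0"
    and "\<forall>\<^sub>F t in at_top. Liminf (at_right t) (\<lambda>s. ereal (\<iota> s)) > 0"
    and "\<forall>\<^sub>F t in at_top. \<forall>x y. dist x y < \<iota> t \<and> sink (sphere x0 t) x y \<longrightarrow>
           path_component (sphere x0 t \<inter> ball x K \<inter> ball y K) x y"
  shows "(connected_space (visual_boundary x0) \<longrightarrow> weakly_chained (visual_boundary x0)) \<and>
         semistable_at_infinity TYPE('a)"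
proof -
  obtain T1 where T1: "\<And>t. T1 \<le> t \<Longrightarrow> Liminf (at_right t) (\<lambda>s. ereal (\<iota> s)) > 0"
      "\<And>t x y. T1 \<le> t \<Longrightarrow> dist x y < \<iota> t \<Longrightarrow> sink (sphere x0 t) x y \<Longrightarrow>
        path_component (sphere x0 t \<inter> ball x K \<inter> ball y K) x y"
    using eventually_conj[OF assms(6,7)] unfolding eventually_at_top_linorder by blast
  define K' where "K' = max 1 K"
  define \<iota>' where "\<iota>' t = min (\<iota> t) K'" for t
  define T0 where "T0 = max 1 T1"
  interpret refining x0 K' \<iota>' T0
  proof
    show "CAT0 TYPE('a)" "proper_space TYPE('a)" "geodesically_complete TYPE('a)" by fact+
    show "1 \<le> K'" "1 \<le> T0" "\<iota>' t \<le> K'" for t by (simp_all add: K'_def T0_def \<iota>'_def)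
    show "0 < \<iota>' t" if "T0 \<le> t" for t
      using assms(5)[of t] that by (simp add: \<iota>'_def K'_def T0_def)
    show "\<exists>c>0. \<exists>\<delta>>0. \<forall>s. t \<le> s \<and> s < t + \<delta> \<longrightarrow> c \<le> \<iota>' s" if "T0 \<le> t" for t
    proof -
      obtain z where z: "0 < ereal z" "ereal z < Liminf (at_right t) (\<lambda>s. ereal (\<iota> s))"
        using ereal_dense2[OF T1(1)[of t]] \<open>T0 \<le> t\<close> by (auto simp: T0_def)
      have "\<forall>\<^sub>F s in at_right t. z < \<iota> s"
        using less_LiminfD[OF z(2)] by simp
      then obtain b where b: "b > t" "\<And>s. t < s \<Longrightarrow> s < b \<Longrightarrow> z < \<iota> s"
        unfolding eventually_at_right_field by blast
      \<comment> \<open>\<open>\<iota> t\<close> takes care of the point \<open>s = t\<close>, which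
        a right neighbourhood leaves out, and \<open>K'\<close> of the truncation in
        \<open>\<iota>'\<close>.\<close>
      define c where "c = min (min z (\<iota> t)) K'"
      have "c > 0"
        using z(1) assms(5)[of t] \<open>T0 \<le> t\<close> by (simp add: c_def K'_def T0_def)
      moreover have "c \<le> \<iota>' s" if "t \<le> s" "s < t + (b - t)" for s
        using b(2)[of s] that by (cases "s = t") (auto simp: c_def \<iota>'_def)
      ultimately show ?thesis using b(1) by (intro exI[of _ c] conjI exI[of _ "b - t"]) auto
    qed
    show "path_component (sphere x0 t \<inter> ball x K') x y"
      if "T0 \<le> t" "dist x y < \<iota>' t" "sink (sphere x0 t) x y" for t x y
    proof (rule path_component_of_subset)
      show "path_component (sphere x0 t \<inter> ball x K \<inter> ball y K) x y"
        using that by (intro T1(2)) (auto simp: T0_def \<iota>'_def)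
    qed (auto simp: K'_def)
  qed
  show ?thesis
    using weakly_chained_boundary properly_homotopic_same_end
    unfolding semistable_at_infinity_def by blast
qed

end
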